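(* Consider the VC-wTGS algorithm (context) with weighting function $\eta(\gamma_{-j})=p(\gamma_j=1\mid\gamma_{-j},\mathcal D)$, so that $$\phi(\gamma)=\frac12\sum_{j\in[P]}\frac{p(\gamma_j=1\mid\gamma_{-j},\mathcal D)}{p(\gamma_j\mid\gamma_{-j},\mathcal D)}.$$ For a given dataset $(X,Y)$ and each $i\in[P]$: (i) $E_{i,T}:=\sum_{t=1}^T\rho^{(t)}p(\gamma_i^{(t)}=1\mid\gamma_{-i}^{(t)},\mathcal D)\to\mathrm{PIP}(i)$ as $T\to\infty$; (ii) $$\mathbb E\left[\left|\sum_{t=1}^T\rho^{(t)}p(\gamma_i^{(t)}=1\mid\gamma_{-i}^{(t)},\mathcal D)-\mathrm{PIP}(i)\right|^2\right]=O\left(\frac{\log T}{T}\left(\frac PS\right)^2\left(\frac{\max_\gamma\phi(\gamma)}{\min_\gamma\phi(\gamma)}\right)^2\right)$$ as $T\to\infty$, where the implied constant depends on the dataset (but not on $T$).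
   Context: Bayesian variable selection model: data $\mathcal D=\{X,Y\}$ with $X\in\mathbb R^{N\times P}$, $Y\in\mathbb R^N$; hyperparameters $h\in(0,1)$, $\tau>0$, $\nu_0,\lambda_0>0$. Prior: $\gamma=(\gamma_1,\dots,\gamma_P)\in\{0,1\}^P$ with $\gamma_i$ i.i.d. Bernoulli$(h)$; $\sigma_\gamma^2\sim\mathrm{InvGamma}(\nu_0/2,\nu_0\lambda_0/2)$; $\beta_\gamma\mid\sigma_\gamma^2\sim\mathcal N(0,\sigma_\gamma^2\tau^{-1}I_{|\gamma|})$ where $|\gamma|=\sum_i\gamma_i$; $Y\mid\gamma,\beta_\gamma,\sigma^2_\gamma\sim\mathcal N(X_\gamma\beta_\gamma,\sigma_\gamma^2I_N)$, where $X_\gamma$ is the submatrix of columns $j$ with $\gamma_j=1$. $p(\gamma\mid\mathcal D)$ is the posterior, $\gamma_{-j}$ denotes $\gamma$ without coordinate $j$, $p(\gamma_j\mid\gamma_{-j},\mathcal D)$ is the conditional posterior probability of the current value of coordinate $j$, and $\mathrm{PIP}(i):=p(\gamma_i=1\mid\mathcal D)$. $\mathrm{flip}(\gamma\mid j)$ is $\gamma$ with coordinate $j$ replaced by $1-\gamma_j$. For a positive weighting function $\eta$, $\phi(\gamma):=\sum_{j=1}^P\frac{\frac12\eta(\gamma_{-j})}{p(\gamma_j\mid\gamma_{-j},\mathcal D)}$ and $f(j\mid\gamma):=\phi(\gamma)^{-1}\frac{\frac12\eta(\gamma_{-j})}{p(\gamma_j\mid\gamma_{-j},\mathcal D)}$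 for $j\in[P]$. VC-wTGS algorithm with parameter $S\in\{1,\dots,P\}$ and $T$ iterations: initialize $\gamma^{(0)}$ with i.i.d. Bernoulli$(h)$ coordinates. Set $Q^{(1)}=1$ and let $Q^{(t)}$, $t\ge2$, be i.i.d. Bernoulli$(S/P)$, independent of everything else. For $t=1,\dots,T$: if $Q^{(t)}=1$, sample $i^{(t)}\sim f(\cdot\mid\gamma^{(t-1)})$, set $\gamma^{(t)}=\mathrm{flip}(\gamma^{(t-1)}\mid i^{(t)})$ and $\tilde\rho^{(t)}=\phi(\gamma^{(t)})^{-1}$; if $Q^{(t)}=0$, set $\gamma^{(t)}=\gamma^{(t-1)}$ and $\tilde\rho^{(t)}=1$. Finally $\rho^{(t)}:=\tilde\rho^{(t)}Q^{(t)}/\sum_{s=1}^T\tilde\rho^{(s)}Q^{(s)}$. *)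

theory Defs
  imports "HOL-Probability.Probability" "HOL-Library.Landau_Symbols"
begin

text \<open>Conventions. Covariate indices are 0,...,P-1 (the paper's [P] shifted by one).
  A model gamma in {0,1}^P is represented by the set of indices j with gamma_j = 1,
  a subset of {..<P}. The design matrix X is a function nat => nat => real
  (row n < N, column j < P), the response Y is nat => real (entry n < N).
  The pair (gamma without coordinate j, j) is represented by (gamma - {j}, j).\<close>

definition flip :: "nat set \<Rightarrow> nat \<Rightarrow> nat set" where
  "flip g j = (if j \<in> g then g - {j} else insert j g)"

definition invgamma_density :: "real \<Rightarrow> real \<Rightarrow> real \<Rightarrow> real" where
  "invgamma_density a b x =
     (if 0 < x then b powr a / Gamma a * x powr (- a - 1) * exp (- b / x) else 0)"

definition gamma_prior :: "nat \<Rightarrow> real \<Rightarrow> nat set \<Rightarrow> real" where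
  "gamma_prior P h g = (if g \<subseteq> {..<P} then h ^ card g * (1 - h) ^ (P - card g) else 0)"

text \<open>Marginal likelihood p(Y | gamma): integrate out sigma^2 (inverse gamma
  (nu0/2, nu0 lambda0/2)) and beta_gamma ~ N(0, sigma^2/tau I), with
  Y | gamma, beta, sigma^2 ~ N(X_gamma beta_gamma, sigma^2 I_N).\<close>
definition marg_lik ::
  "nat \<Rightarrow> (nat \<Rightarrow> nat \<Rightarrow> real) \<Rightarrow> (nat \<Rightarrow> real) \<Rightarrow> real \<Rightarrow> real \<Rightarrow> real \<Rightarrow> nat set \<Rightarrow> real" where
  "marg_lik N X Y tau nu0 lambda0 g =
     (LINT s:{0<..}|lborel.
        invgamma_density (nu0 / 2) (nu0 * lambda0 / 2) s *
        (LINT b|PiM g (\<lambda>_. lborel).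
            (\<Prod>j\<in>g. normal_density 0 (sqrt (s / tau)) (b j)) *
            (\<Prod>n<N. normal_density (\<Sum>j\<in>g. X n j * b j) (sqrt s) (Y n))))"

definition post ::
  "nat \<Rightarrow> nat \<Rightarrow> (nat \<Rightarrow> nat \<Rightarrow> real) \<Rightarrow> (nat \<Rightarrow> real) \<Rightarrow> real \<Rightarrow> real \<Rightarrow> real \<Rightarrow> real \<Rightarrow> nat set \<Rightarrow> real" where
  "post N P X Y h tau nu0 lambda0 g =
     gamma_prior P h g * marg_lik N X Y tau nu0 lambda0 g /
     (\<Sum>g'\<in>Pow {..<P}. gamma_prior P h g' * marg_lik N X Y tau nu0 lambda0 g')"

definition cond_cur :: "(nat set \<Rightarrow> real) \<Rightarrow> nat set \<Rightarrow> nat \<Rightarrow> real" where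
  "cond_cur pst g j = pst g / (pst g + pst (flip g j))"

text \<open>p(gamma_j = 1 | gamma_{-j}, D), as a function of (gamma_{-j}, j) = (A, j).\<close>
definition cond_one :: "(nat set \<Rightarrow> real) \<Rightarrow> nat set \<Rightarrow> nat \<Rightarrow> real" where
  "cond_one pst A j = pst (insert j A) / (pst (insert j A) + pst (A - {j}))"

definition PIP :: "nat \<Rightarrow> (nat set \<Rightarrow> real) \<Rightarrow> nat \<Rightarrow> real" where
  "PIP P pst i = (\<Sum>g\<in>{g\<in>Pow {..<P}. i \<in> g}. pst g)"

definition wphi :: "nat \<Rightarrow> (nat set \<Rightarrow> real) \<Rightarrow> (nat set \<Rightarrow> nat \<Rightarrow> real) \<Rightarrow> nat set \<Rightarrow> real" where
  "wphi P pst eta g = (\<Sum>j<P. (eta (g - {j}) j / 2) / cond_cur pst g j)"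

definition fsel :: "nat \<Rightarrow> (nat set \<Rightarrow> real) \<Rightarrow> (nat set \<Rightarrow> nat \<Rightarrow> real) \<Rightarrow> nat set \<Rightarrow> nat \<Rightarrow> real" where
  "fsel P pst eta g j =
     (if j < P then (eta (g - {j}) j / 2) / cond_cur pst g j / wphi P pst eta g else 0)"

text \<open>Transition probability at iteration t (t >= 1) of VC-wTGS: from state a, with
  Q^(t) = q, to state b. Q^(1) = 1 and Q^(t) ~ Bernoulli(S/P) for t >= 2; on Q = 1 the
  coordinate i^(t) ~ f(. | a) is flipped, on Q = 0 the state is kept.\<close>
definition vc_trans ::
  "nat \<Rightarrow> nat \<Rightarrow> (nat set \<Rightarrow> real) \<Rightarrow> (nat set \<Rightarrow> nat \<Rightarrow> real) \<Rightarrow> nat \<Rightarrow> nat set \<Rightarrow> bool \<Rightarrow> nat set \<Rightarrow> real" where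
  "vc_trans P S pst eta t a q b =
     (if q then (if t = 1 then 1 else real S / real P) *
                (\<Sum>j<P. if b = flip a j then fsel P pst eta a j else 0)
      else (if t = 1 then 0 else 1 - real S / real P) * (if b = a then 1 else 0))"

text \<open>The process (gamma^(t))_{t>=0}, (Q^(t))_{t>=1} on a probability space M is a run of
  VC-wTGS: all finite-dimensional joint distributions are those of the algorithm
  (gamma^(0) with i.i.d. Bernoulli(h) coordinates).\<close>
definition is_vc_wtgs_run ::
  "'w measure \<Rightarrow> nat \<Rightarrow> nat \<Rightarrow> real \<Rightarrow> (nat set \<Rightarrow> real) \<Rightarrow> (nat set \<Rightarrow> nat \<Rightarrow> real) \<Rightarrow>
   (nat \<Rightarrow> 'w \<Rightarrow> nat set) \<Rightarrow> (nat \<Rightarrow> 'w \<Rightarrow> bool) \<Rightarrow> bool" where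
  "is_vc_wtgs_run M P S h pst eta G Q \<longleftrightarrow>
     prob_space M \<and>
     (\<forall>t. G t \<in> M \<rightarrow>\<^sub>M count_space UNIV) \<and>
     (\<forall>t. Q t \<in> M \<rightarrow>\<^sub>M count_space UNIV) \<and>
     (\<forall>T (a :: nat \<Rightarrow> nat set) (q :: nat \<Rightarrow> bool).
        measure M {w \<in> space M. (\<forall>t\<le>T. G t w = a t) \<and> (\<forall>t\<in>{1..T}. Q t w = q t)} =
        gamma_prior P h (a 0) * (\<Prod>t\<in>{1..T}. vc_trans P S pst eta t (a (t - 1)) (q t) (a t)))"

definition rho_tilde ::
  "nat \<Rightarrow> (nat set \<Rightarrow> real) \<Rightarrow> (nat set \<Rightarrow> nat \<Rightarrow> real) \<Rightarrow> (nat \<Rightarrow> 'w \<Rightarrow> nat set) \<Rightarrow> (nat \<Rightarrow> 'w \<Rightarrow> bool) \<Rightarrow> nat \<Rightarrow> 'w \<Rightarrow> real" where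
  "rho_tilde P pst eta G Q t w = (if Q t w then 1 / wphi P pst eta (G t w) else 1)"

definition rho ::
  "nat \<Rightarrow> (nat set \<Rightarrow> real) \<Rightarrow> (nat set \<Rightarrow> nat \<Rightarrow> real) \<Rightarrow> (nat \<Rightarrow> 'w \<Rightarrow> nat set) \<Rightarrow> (nat \<Rightarrow> 'w \<Rightarrow> bool) \<Rightarrow> nat \<Rightarrow> nat \<Rightarrow> 'w \<Rightarrow> real" where
  "rho P pst eta G Q T t w =
     (rho_tilde P pst eta G Q t w * (if Q t w then 1 else 0)) /
     (\<Sum>s\<in>{1..T}. rho_tilde P pst eta G Q s w * (if Q s w then 1 else 0))"

definition est_E ::
  "nat \<Rightarrow> (nat set \<Rightarrow> real) \<Rightarrow> (nat set \<Rightarrow> nat \<Rightarrow> real) \<Rightarrow> (nat \<Rightarrow> 'w \<Rightarrow> nat set) \<Rightarrow> (nat \<Rightarrow> 'w \<Rightarrow> bool) \<Rightarrow> nat \<Rightarrow> nat \<Rightarrow> 'w \<Rightarrow> real" where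
  "est_E P pst eta G Q i T w =
     (\<Sum>t\<in>{1..T}. rho P pst eta G Q T t w * cond_one pst (G t w - {i}) i)"

end

theory Submission
  imports Defs "HOL-Library.Discrete_Functions"
begin

text \<open>Let \<open>K\<close> be the kernel that flips a coordinate drawn from \<open>f(\<cdot>|\<gamma>)\<close>. It is reversible for
  \<open>p(\<gamma>|D) \<phi>(\<gamma>)\<close>, so \<open>\<psi> = (p(\<gamma>\<^sub>i = 1|\<gamma>\<^sub>-\<^sub>i, D) - PIP(i)) / \<phi>\<close> has stationary mean zero and the
  Poisson equation \<open>u - K u = \<psi>\<close> has a solution. As the state stays put when \<open>Q = 0\<close>, the numerator
  \<open>A\<^sub>T = \<Sum> Q\<^sup>(\<^sup>t\<^sup>) \<psi>(\<gamma>\<^sup>(\<^sup>t\<^sup>))\<close> of the error \<open>E\<^sub>i\<^sub>,\<^sub>T - PIP(i)\<close> differs from the martingale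
  \<open>\<Sum> Q\<^sup>(\<^sup>t\<^sup>) (u(\<gamma>\<^sup>(\<^sup>t\<^sup>)) - K u(\<gamma>\<^sup>(\<^sup>t\<^sup>-\<^sup>1\<^sup>)))\<close> by a bounded telescoping sum, whence \<open>E A\<^sub>T\<^sup>2 = O(T)\<close>;
  the number \<open>N\<^sub>T\<close> of updates satisfies \<open>E (N\<^sub>T - T S / P)\<^sup>2 = O(T)\<close> in the same way. Both
  bounds give almost sure convergence of the averages along the squares, hence along all \<open>T\<close>.
  The denominator is at least \<open>N\<^sub>T / max \<phi>\<close> and the error at most \<open>1\<close>, so the mean square error is
  \<open>O(1 / T)\<close>.\<close>

section \<open>Positivity of the posterior\<close>

lemma set_integrable_powr_to_inf:
  fixes e :: real
  assumes "e < -1"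
  shows "set_integrable lborel {1..} (\<lambda>x. x powr e)"
proof -
  have "(\<lambda>x. x powr e) integrable_on {1..}"
    using has_integral_powr_to_inf[OF assms, of 1] by (auto simp: integrable_on_def)
  then have "(\<lambda>x. x powr e) absolutely_integrable_on {1..}"
    by (rule nonnegative_absolutely_integrable_1) auto
  then show ?thesis
    unfolding set_integrable_def by (subst (asm) integrable_completion) auto
qed

text \<open>A single term \<open>(b / s) ^ m / fact m\<close> of the exponential series bounds
  \<open>exp (b / s)\<close> from below, and for \<open>m\<close> at least \<open>c\<close> it
  absorbs the singular power of \<open>s\<close>.\<close>

lemma powr_exp_bounded:
  fixes b c :: real
  assumes "0 < b"
  obtains B where "\<And>s. 0 < s \<Longrightarrow> s \<le> 1 \<Longrightarrow> s powr (- c) * exp (- b / s) \<le> B"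
proof -
  obtain m :: nat where m: "c \<le> real m" using real_arch_simple by blast
  have "s powr (- c) * exp (- b / s) \<le> fact m / b ^ m" if s: "0 < s" "s \<le> 1" for s
  proof -
    have "s powr (- c) \<le> s powr (- real m)"
      using s m by (intro powr_mono') auto
    then have 1: "s powr (- c) \<le> 1 / s ^ m"
      using s by (simp add: powr_minus powr_realpow divide_inverse)
    have "(b / s) ^ m / fact m \<le> exp (b / s)"
      using sum_le_suminf[OF summable_exp_generic[of "b / s"], of "{m}"] s assms
      by (simp add: exp_def divide_inverse mult.commute)
    then have "exp (- b / s) \<le> fact m * s ^ m / b ^ m"
      using s assms by (simp add: exp_minus field_simps)
    then have "s powr (- c) * exp (- b / s) \<le> 1 / s ^ m * (fact m * s ^ m / b ^ m)"
      using 1 s by (intro mult_mono) auto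
    then show ?thesis using s by simp
  qed
  then show ?thesis by (rule that)
qed

text \<open>Two dominating functions are glued together: the exponential tames the power on
  \<open>(0, 1]\<close>, and beyond \<open>1\<close> the exponent \<open>- a - 1\<close> is already
  integrable because \<open>a\<close> is positive.\<close>

lemma set_integrable_inverse_powr_exp:
  fixes a b c :: real
  assumes "0 < a" "0 < b" "0 \<le> c"
  shows "set_integrable lborel {0<..} (\<lambda>s. s powr (- a - 1 - c) * exp (- b / s))"
proof -
  obtain B where B: "\<And>s. 0 < s \<Longrightarrow> s \<le> 1 \<Longrightarrow> s powr (- (a + 1 + c)) * exp (- b / s) \<le> B"
    using powr_exp_bounded[OF assms(2)] by metis
  have 1: "set_integrable lborel {1..} (\<lambda>x. x powr (- a - 1))"
    using assms by (intro set_integrable_powr_to_inf) auto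
  have 2: "set_integrable lborel {0..1} (\<lambda>x::real. B)"
    by (simp add: set_integrable_def)
  show ?thesis
    unfolding set_integrable_def
  proof (rule Bochner_Integration.integrable_bound[OF Bochner_Integration.integrable_add
        [OF 2[unfolded set_integrable_def] 1[unfolded set_integrable_def]]])
    have B0: "0 \<le> B" using order_trans[OF _ B[of 1]] by simp
    have "s powr (- a - 1 - c) * exp (- b / s) \<le> s powr (- a - 1)" if "s > 1" for s
    proof -
      have "s powr (- a - 1 - c) \<le> s powr (- a - 1)" using that assms by (intro powr_mono) auto
      moreover have "exp (- b / s) \<le> 1" using that assms by simp
      ultimately show ?thesis using mult_mono[of "s powr (- a - 1 - c)" _ "exp (- b / s)" 1] by simp
    qed
    moreover have "s powr (- a - 1 - c) * exp (- b / s) \<le> B" if "0 < s" "s \<le> 1" for s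
      using B[OF that] by (simp add: diff_diff_eq[symmetric])
    \<comment> \<open>At \<open>s = 1\<close> both indicators are active; there the left side is
      \<open>exp (- b)\<close>, below \<open>B + 1\<close>.\<close>
    ultimately have "norm (indicator {0<..} s *\<^sub>R (s powr (- a - 1 - c) * exp (- b / s)))
      \<le> norm (indicator {0..1} s *\<^sub>R B + indicator {1..} s *\<^sub>R s powr (- a - 1))" for s
      using B0 order_trans[of "exp (- b)" 1 "B + 1"] assms
      by (cases "0 < s"; cases "s = 1"; cases "s < 1") (auto simp: indicator_def)
    then show "AE s in lborel. norm (indicator {0<..} s *\<^sub>R (s powr (- a - 1 - c) * exp (- b / s)))
      \<le> norm (indicator {0..1} s *\<^sub>R B + indicator {1..} s *\<^sub>R s powr (- a - 1))"
      by simp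
  qed measurable
qed

text \<open>The function \<open>g\<close> only certifies that the measure is not null.\<close>

lemma integral_pos_everywhere:
  fixes f g :: "'a \<Rightarrow> real"
  assumes "integrable M f" "\<And>x. x \<in> space M \<Longrightarrow> 0 < f x" "integral\<^sup>L M g \<noteq> 0"
  shows "0 < integral\<^sup>L M f"
proof -
  have nonneg: "AE x in M. 0 \<le> f x" using assms(2) by (intro AE_I2) (simp add: less_imp_le)
  have "integral\<^sup>L M f \<noteq> 0"
  proof
    assume "integral\<^sup>L M f = 0"
    then have "AE x in M. f x = 0"
      using integral_nonneg_eq_0_iff_AE[OF assms(1) nonneg] by simp
    then have "AE x in M. g x = 0"
      by (rule AE_mp) (rule AE_I2, use assms(2) in force)
    then have "integral\<^sup>L M g = 0"
      by (rule integral_eq_zero_AE)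
    with assms(3) show False by simp
  qed
  then show ?thesis using integral_nonneg_AE[OF nonneg] by simp
qed

section \<open>Positivity of the marginal likelihood\<close>

context
  fixes N :: nat and X :: "nat \<Rightarrow> nat \<Rightarrow> real" and Y :: "nat \<Rightarrow> real"
    and tau nu0 lambda0 :: real and g :: "nat set"
  assumes tau: "0 < tau" and nu0: "0 < nu0" and lambda0: "0 < lambda0" and fin: "finite g"
begin

interpretation product_sigma_finite "\<lambda>_::nat. lborel :: real measure" ..

abbreviation (input) coef_lik :: "real \<Rightarrow> (nat \<Rightarrow> real) \<Rightarrow> real" where
  "coef_lik s b \<equiv> (\<Prod>j\<in>g. normal_density 0 (sqrt (s / tau)) (b j)) *
     (\<Prod>n<N. normal_density (\<Sum>j\<in>g. X n j * b j) (sqrt s) (Y n))"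

lemma coef_prior_integral:
  assumes "0 < s"
  shows "integrable (PiM g (\<lambda>_. lborel)) (\<lambda>b. \<Prod>j\<in>g. normal_density 0 (sqrt (s / tau)) (b j))"
    and "(LINT b|PiM g (\<lambda>_. lborel). (\<Prod>j\<in>g. normal_density 0 (sqrt (s / tau)) (b j))) = 1"
proof -
  have "sqrt (s / tau) > 0" using assms tau by simp
  then show "integrable (PiM g (\<lambda>_. lborel)) (\<lambda>b. \<Prod>j\<in>g. normal_density 0 (sqrt (s / tau)) (b j))"
    and "(LINT b|PiM g (\<lambda>_. lborel). (\<Prod>j\<in>g. normal_density 0 (sqrt (s / tau)) (b j))) = 1"
    using product_integrable_prod[OF fin, of "\<lambda>_. normal_density 0 (sqrt (s / tau))"]
      product_integral_prod[OF fin, of "\<lambda>_. normal_density 0 (sqrt (s / tau))"]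
    by (simp_all del: real_sqrt_gt_0_iff)
qed

lemma normal_density_le:
  assumes "0 < s"
  shows "normal_density m (sqrt s) y \<le> (2 * pi * s) powr (- 1 / 2)"
proof -
  have "normal_density m (sqrt s) y \<le> 1 / sqrt (2 * pi * s)"
    using assms mult_left_mono[of "exp (- (y - m)\<^sup>2 / (2 * s))" 1 "1 / sqrt (2 * pi * s)"]
    by (simp add: normal_density_def)
  also have "\<dots> = (2 * pi * s) powr (- (1 / 2))"
    using assms by (subst powr_minus_divide, subst powr_half_sqrt) auto
  finally show ?thesis by simp
qed

text \<open>The bound is uniform in the means, so the coefficients can afterwards be integrated out
  against their prior of total mass one.\<close>

lemma lik_le:
  assumes "0 < s"
  shows "(\<Prod>n<N. normal_density (m n) (sqrt s) (Y n)) \<le> (2 * pi * s) powr (- real N / 2)"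
proof -
  have "(\<Prod>n<N. normal_density (m n) (sqrt s) (Y n)) \<le> (\<Prod>n<N. (2 * pi * s) powr (- 1 / 2))"
    using assms by (intro prod_mono) (use normal_density_le in auto)
  also have "\<dots> = (2 * pi * s) powr (- real N / 2)"
    using assms by (simp add: powr_realpow[symmetric] powr_powr)
  finally show ?thesis .
qed

lemma coef_lik_measurable [measurable]: "coef_lik s \<in> borel_measurable (PiM g (\<lambda>_. lborel))"
  unfolding normal_density_def by measurable

lemma coef_lik_nonneg: "0 \<le> coef_lik s b"
  by (intro mult_nonneg_nonneg prod_nonneg) auto

lemma coef_lik_le:
  assumes "0 < s"
  shows "coef_lik s b \<le> (2 * pi * s) powr (- real N / 2) *
           (\<Prod>j\<in>g. normal_density 0 (sqrt (s / tau)) (b j))"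
  by (subst mult.commute) (intro mult_right_mono lik_le assms prod_nonneg, auto)

lemma coef_lik_integrable:
  assumes "0 < s"
  shows "integrable (PiM g (\<lambda>_. lborel)) (coef_lik s)"
proof (rule Bochner_Integration.integrable_bound)
  show "integrable (PiM g (\<lambda>_. lborel)) (\<lambda>b. (2 * pi * s) powr (- real N / 2) *
           (\<Prod>j\<in>g. normal_density 0 (sqrt (s / tau)) (b j)))"
    using coef_prior_integral(1)[OF assms] by simp
  show "AE b in PiM g (\<lambda>_. lborel). norm (coef_lik s b) \<le> norm ((2 * pi * s) powr (- real N / 2) *
           (\<Prod>j\<in>g. normal_density 0 (sqrt (s / tau)) (b j)))"
  proof (rule AE_I2)
    fix b
    show "norm (coef_lik s b) \<le> norm ((2 * pi * s) powr (- real N / 2) *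
           (\<Prod>j\<in>g. normal_density 0 (sqrt (s / tau)) (b j)))"
      using order_trans[OF coef_lik_nonneg coef_lik_le[OF assms]] coef_lik_nonneg coef_lik_le[OF assms]
      by (simp only: real_norm_def abs_of_nonneg)
  qed
qed measurable

lemma coef_lik_integral_pos:
  assumes "0 < s"
  shows "0 < (LINT b|PiM g (\<lambda>_. lborel). coef_lik s b)"
proof (rule integral_pos_everywhere[OF coef_lik_integrable[OF assms],
      where g = "\<lambda>b. \<Prod>j\<in>g. normal_density 0 (sqrt (s / tau)) (b j)"])
  show "0 < coef_lik s b" for b
    using assms tau by (intro mult_pos_pos prod_pos normal_density_pos ballI) auto
qed (use coef_prior_integral(2)[OF assms] in simp)

lemma coef_lik_integral_le:
  assumes "0 < s"
  shows "(LINT b|PiM g (\<lambda>_. lborel). coef_lik s b) \<le> (2 * pi * s) powr (- real N / 2)"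
proof -
  have "(LINT b|PiM g (\<lambda>_. lborel). coef_lik s b) \<le>
     (LINT b|PiM g (\<lambda>_. lborel). (2 * pi * s) powr (- real N / 2) *
           (\<Prod>j\<in>g. normal_density 0 (sqrt (s / tau)) (b j)))"
    using coef_prior_integral(1)[OF assms] coef_lik_integrable[OF assms] coef_lik_le[OF assms]
    by (intro integral_mono) auto
  then show ?thesis using coef_prior_integral(2)[OF assms] by simp
qed

text \<open>A Bochner integral defaults to zero when the integrand is not integrable, so a positive
  integrand is not enough. Bounding the likelihood by a power of \<open>s\<close> gives
  integrability; a zero integral would then force the integrand to vanish almost everywhere.\<close>

lemma marg_lik_pos: "0 < marg_lik N X Y tau nu0 lambda0 g"
proof -
  define a b where "a = nu0 / 2" and "b = nu0 * lambda0 / 2"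
  have ab: "0 < a" "0 < b" using nu0 lambda0 by (auto simp: a_def b_def)
  define L where "L s = (LINT b|PiM g (\<lambda>_. lborel). coef_lik s b)" for s
  define F where "F s = indicator {0<..} s * (invgamma_density a b s * L s)" for s :: real
  interpret PiM: sigma_finite_measure "PiM g (\<lambda>_. lborel :: real measure)"
    by (rule sigma_finite[OF fin])
  have [measurable]: "L \<in> borel_measurable lborel"
    unfolding L_def normal_density_def by measurable
  have [measurable]: "invgamma_density a b \<in> borel_measurable lborel"
    unfolding invgamma_density_def by measurable
  have ig_pos: "0 < invgamma_density a b s" if "0 < s" for s
    using ab that by (simp add: invgamma_density_def)
  \<comment> \<open>Collects the normalising constant of the inverse gamma density and the part of
    the likelihood bound free of \<open>s\<close>.\<close>
  define K where "K = b powr a / Gamma a * (2 * pi) powr (- real N / 2)"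
  have "set_integrable lborel {0<..} (\<lambda>s. K * (s powr (- a - 1 - real N / 2) * exp (- b / s)))"
    using set_integrable_inverse_powr_exp[OF ab, of "real N / 2"] by simp
  then have F_int: "integrable lborel F"
    unfolding set_integrable_def
  proof (rule Bochner_Integration.integrable_bound)
    show "AE s in lborel. norm (F s) \<le>
       norm (indicator {0<..} s *\<^sub>R (K * (s powr (- a - 1 - real N / 2) * exp (- b / s))))"
    proof (intro AE_I2)
      fix s :: real
      show "norm (F s) \<le> norm (indicator {0<..} s *\<^sub>R (K * (s powr (- a - 1 - real N / 2) * exp (- b / s))))"
      proof (cases "0 < s")
        case True
        have "invgamma_density a b s * L s \<le> invgamma_density a b s * (2 * pi * s) powr (- real N / 2)"
          unfolding L_def using ig_pos[OF True] coef_lik_integral_le[OF True]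
          by (intro mult_left_mono) auto
        also have "\<dots> = K * (s powr (- a - 1 - real N / 2) * exp (- b / s))"
          using True powr_add[of s "- a - 1" "- real N / 2"]
          by (simp add: invgamma_density_def K_def powr_mult)
        finally have "\<bar>invgamma_density a b s * L s\<bar> \<le> \<bar>K * (s powr (- a - 1 - real N / 2) * exp (- b / s))\<bar>"
          using ig_pos[OF True] coef_lik_integral_pos[OF True] by (simp add: L_def)
        then show ?thesis using True by (simp add: F_def)
      qed (simp add: F_def)
    qed
  qed (unfold F_def, measurable)
  have F_nonneg: "0 \<le> F s" for s
    using ig_pos[of s] coef_lik_integral_pos[of s] by (auto simp: F_def L_def indicator_def)
  have "integral\<^sup>L lborel F \<noteq> 0"
  proof
    assume "integral\<^sup>L lborel F = 0"
    then have "AE s in lborel. F s = 0"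
      using integral_nonneg_eq_0_iff_AE[OF F_int] F_nonneg by simp
    \<comment> \<open>The integrand is positive on all of \<open>(0, 1]\<close>, so this interval of
      length one would be null.\<close>
    then have "AE s in lborel. s \<notin> {0<..(1::real)}"
      by (rule AE_mp)
        (use ig_pos coef_lik_integral_pos in \<open>force intro!: AE_I2 simp: F_def L_def\<close>)
    then have "emeasure lborel {0<..(1::real)} = 0"
      by (subst (asm) AE_iff_measurable[of "{0<..1}"]) auto
    then show False by simp
  qed
  moreover have "marg_lik N X Y tau nu0 lambda0 g = integral\<^sup>L lborel F"
    by (simp add: marg_lik_def set_lebesgue_integral_def F_def[abs_def] L_def a_def b_def)
  ultimately show ?thesis using Bochner_Integration.integral_nonneg[of lborel F] F_nonneg by fastforce
qed

end

section \<open>Prior and posterior masses\<close>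

lemma gamma_prior_pos:
  assumes "0 < h" "h < 1" "g \<subseteq> {..<P}"
  shows "0 < gamma_prior P h g"
  using assms by (simp add: gamma_prior_def)

text \<open>The sum over subsets is the expansion of a product of \<open>P\<close> factors
  \<open>h + (1 - h)\<close>.\<close>

lemma sum_gamma_prior: "(\<Sum>g\<in>Pow {..<P}. gamma_prior P h g) = 1"
proof -
  have "(\<Sum>g\<in>Pow {..<P}. gamma_prior P h g) = (\<Sum>g\<in>Pow {..<P}. (\<Prod>j\<in>g. h) * (\<Prod>j\<in>{..<P} - g. 1 - h))"
    by (intro sum.cong) (auto simp: gamma_prior_def card_Diff_subset finite_subset)
  also have "\<dots> = (\<Prod>j<P. h + (1 - h))"
    by (subst prod_add) auto
  finally show ?thesis by simp
qed

lemma
  assumes "0 < h" "h < 1" "0 < tau" "0 < nu0" "0 < lambda0"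
  shows post_pos: "g \<subseteq> {..<P} \<Longrightarrow> 0 < post N P X Y h tau nu0 lambda0 g"
    and sum_post: "(\<Sum>g\<in>Pow {..<P}. post N P X Y h tau nu0 lambda0 g) = 1"
proof -
  have pos: "0 < gamma_prior P h g * marg_lik N X Y tau nu0 lambda0 g" if "g \<subseteq> {..<P}" for g
    using assms that finite_subset[OF that]
    by (intro mult_pos_pos gamma_prior_pos marg_lik_pos) auto
  then have "0 < (\<Sum>g\<in>Pow {..<P}. gamma_prior P h g * marg_lik N X Y tau nu0 lambda0 g)"
    by (intro sum_pos) auto
  then show "g \<subseteq> {..<P} \<Longrightarrow> 0 < post N P X Y h tau nu0 lambda0 g"
    "(\<Sum>g\<in>Pow {..<P}. post N P X Y h tau nu0 lambda0 g) = 1"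
    using pos by (auto simp: post_def simp flip: sum_divide_distrib)
qed

section \<open>A strong law from second moments\<close>

text \<open>From the last square \<open>k * k\<close> below \<open>n\<close> to \<open>n\<close>
  there are at most \<open>2 * k\<close> steps. They change \<open>s\<close> by at most
  \<open>2 * C * k\<close>, which is negligible against \<open>k * k\<close>.\<close>

lemma average_tendsto_0_square_subseq:
  fixes s :: "nat \<Rightarrow> real"
  assumes step: "\<And>n. \<bar>s (Suc n) - s n\<bar> \<le> C"
    and sub: "(\<lambda>k. s (k\<^sup>2) / real (k\<^sup>2)) \<longlonglongrightarrow> 0"
  shows "(\<lambda>n. s n / real n) \<longlonglongrightarrow> 0"
proof (rule Lim_null_comparison)
  have C: "C \<ge> 0" using step[of 0] by linarith
  have incr: "\<bar>s (m + d) - s m\<bar> \<le> C * real d" for m d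
  proof (induction d)
    case (Suc d)
    then show ?case using step[of "m + d"] by (simp add: algebra_simps)
  qed simp
  show "\<forall>\<^sub>F n in sequentially. norm (s n / real n)
      \<le> \<bar>s ((floor_sqrt n)\<^sup>2) / real ((floor_sqrt n)\<^sup>2)\<bar> + 2 * C / real (floor_sqrt n)"
    using eventually_gt_at_top[of 0]
  proof eventually_elim
    case (elim n)
    define k where "k = floor_sqrt n"
    have k1: "k\<^sup>2 \<le> n" by (simp add: k_def)
    have k2: "n < (Suc k)\<^sup>2" unfolding k_def by (rule Suc_floor_sqrt_power2_gt)
    have kpos: "k > 0" using elim by (simp add: k_def)
    have "real (n - k\<^sup>2) \<le> real (2 * k)"
      using k2 by (simp add: power2_eq_square)
    then have "C * real (n - k\<^sup>2) \<le> C * (2 * real k)"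
      using C by (intro mult_left_mono) auto
    moreover have "\<bar>s n - s (k\<^sup>2)\<bar> \<le> C * real (n - k\<^sup>2)"
      using incr[of "k\<^sup>2" "n - k\<^sup>2"] k1 by simp
    ultimately have "\<bar>s n\<bar> \<le> \<bar>s (k\<^sup>2)\<bar> + 2 * C * real k" by linarith
    then have "\<bar>s n\<bar> / real n \<le> (\<bar>s (k\<^sup>2)\<bar> + 2 * C * real k) / real n"
      by (simp add: divide_right_mono)
    also have "\<dots> \<le> (\<bar>s (k\<^sup>2)\<bar> + 2 * C * real k) / real (k\<^sup>2)"
      using k1 kpos C elim by (intro divide_left_mono) (auto simp flip: of_nat_power)
    also have "\<dots> = \<bar>s (k\<^sup>2)\<bar> / real (k\<^sup>2) + 2 * C / real k"
      using kpos by (simp add: add_divide_distrib power2_eq_square)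
    finally show ?case by (simp add: k_def)
  qed
  have lim: "filterlim floor_sqrt at_top at_top"
    unfolding filterlim_at_top
  proof
    fix Z
    show "\<forall>\<^sub>F n in sequentially. Z \<le> floor_sqrt n"
      using eventually_ge_at_top[of "Z\<^sup>2"]
      by eventually_elim (rule le_floor_sqrtI)
  qed
  have "(\<lambda>k. \<bar>s (k\<^sup>2) / real (k\<^sup>2)\<bar> + 2 * C / real k) \<longlonglongrightarrow> 0"
    using tendsto_add[OF tendsto_rabs_zero[OF sub] lim_const_over_n[of "2 * C"]] by simp
  from filterlim_compose[OF this lim]
  show "(\<lambda>n. \<bar>s ((floor_sqrt n)\<^sup>2) / real ((floor_sqrt n)\<^sup>2)\<bar> + 2 * C / real (floor_sqrt n)) \<longlonglongrightarrow> 0" .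
qed

text \<open>By monotone convergence the series of the \<open>f n\<close> has finite integral, so it
  converges almost everywhere and its terms tend to zero.\<close>

lemma AE_tendsto_0_summable_integral:
  fixes f :: "nat \<Rightarrow> 'a \<Rightarrow> real"
  assumes int: "\<And>n. integrable M (f n)" and nonneg: "\<And>n x. 0 \<le> f n x"
    and summ: "summable (\<lambda>n. integral\<^sup>L M (f n))"
  shows "AE x in M. (\<lambda>n. f n x) \<longlonglongrightarrow> 0"
proof -
  have meas[measurable]: "\<And>n. f n \<in> borel_measurable M" using int by auto
  have "(\<integral>\<^sup>+x. (\<Sum>n. ennreal (f n x)) \<partial>M) = (\<Sum>n. \<integral>\<^sup>+x. ennreal (f n x) \<partial>M)"
    by (intro nn_integral_suminf) auto
  also have "\<dots> = (\<Sum>n. ennreal (integral\<^sup>L M (f n)))"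
    using int nonneg by (simp add: nn_integral_eq_integral)
  also have "\<dots> = ennreal (\<Sum>n. integral\<^sup>L M (f n))"
    using nonneg summ by (intro suminf_ennreal_eq summable_sums) auto
  finally have "(\<integral>\<^sup>+x. (\<Sum>n. ennreal (f n x)) \<partial>M) \<noteq> \<infinity>" by simp
  then have "AE x in M. (\<Sum>n. ennreal (f n x)) \<noteq> \<infinity>"
    by (intro nn_integral_noteq_infinite) auto
  then show ?thesis
  proof eventually_elim
    case (elim x)
    then have "summable (\<lambda>n. f n x)"
      using nonneg by (intro summable_suminf_not_top) auto
    then show ?case by (rule summable_LIMSEQ_zero)
  qed
qed

context prob_space
begin

text \<open>Along the squares the averages have second moments at most
  \<open>K / (real k)\<^sup>2\<close>, which are summable; the uniform bound on the
  \<open>X t\<close> fills the gaps between squares.\<close>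

lemma AE_average_tendsto_0:
  fixes X :: "nat \<Rightarrow> 'a \<Rightarrow> real"
  assumes [measurable]: "\<And>t. random_variable borel (X t)"
    and bound: "AE w in M. \<forall>t. \<bar>X t w\<bar> \<le> C"
    and second_moment: "\<And>n. expectation (\<lambda>w. (\<Sum>t<n. X t w)\<^sup>2) \<le> K * real n"
  shows "AE w in M. (\<lambda>n. (\<Sum>t<n. X t w) / real n) \<longlonglongrightarrow> 0"
proof -
  define f where "f k w = ((\<Sum>t<k\<^sup>2. X t w) / real (k\<^sup>2))\<^sup>2" for k w
  have sum_bound: "AE w in M. \<bar>\<Sum>t<n. X t w\<bar> \<le> real n * C" for n
    using bound
  proof eventually_elim
    case (elim w)
    have "\<bar>\<Sum>t<n. X t w\<bar> \<le> (\<Sum>t<n. \<bar>X t w\<bar>)" by (rule sum_abs)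
    also have "\<dots> \<le> (\<Sum>t<n. C)" using elim by (intro sum_mono) auto
    finally show ?case by simp
  qed
  have int: "integrable M (\<lambda>w. (\<Sum>t<n. X t w)\<^sup>2)" for n
  proof (rule integrable_const_bound[where B = "(real n * C)\<^sup>2"])
    show "AE w in M. norm ((\<Sum>t<n. X t w)\<^sup>2) \<le> (real n * C)\<^sup>2"
      using sum_bound[of n] by eventually_elim (simp add: abs_le_square_iff[symmetric])
  qed measurable
  have f_nonneg: "0 \<le> f k w" for k w
    by (simp add: f_def)
  have f_int: "integrable M (f k)" for k
    unfolding f_def power_divide using int by simp
  have f_le: "expectation (f k) \<le> K / (real k)\<^sup>2" for k
  proof (cases "k = 0")
    case False
    have "expectation (f k) = expectation (\<lambda>w. (\<Sum>t<k\<^sup>2. X t w)\<^sup>2) / (real (k\<^sup>2))\<^sup>2"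
      unfolding f_def power_divide by simp
    also have "\<dots> \<le> K * real (k\<^sup>2) / (real (k\<^sup>2))\<^sup>2"
      by (intro divide_right_mono second_moment) auto
    finally show ?thesis using False by (simp add: power2_eq_square)
  qed (simp add: f_def[abs_def])
  have "summable (\<lambda>k. K / (real k)\<^sup>2)"
    using summable_mult[OF inverse_power_summable[of 2, where 'a = real], of K]
    by (simp add: field_simps)
  then have "summable (\<lambda>k. expectation (f k))"
    by (rule summable_comparison_test'[where N = 0])
       (simp add: f_le f_nonneg)
  then have "AE w in M. (\<lambda>k. f k w) \<longlonglongrightarrow> 0"
    by (intro AE_tendsto_0_summable_integral f_int f_nonneg)
  with bound show ?thesis
  proof eventually_elim
    case (elim w)
    have "(\<lambda>k. (\<Sum>t<k\<^sup>2. X t w) / real (k\<^sup>2)) \<longlonglongrightarrow> 0"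
      using tendsto_real_sqrt[OF elim(2)] by (subst tendsto_rabs_zero_iff[symmetric]) (simp add: f_def)
    then show ?case
      using elim(1) by (intro average_tendsto_0_square_subseq[where C = C]) auto
  qed
qed

text \<open>Transfers the second moment bound of a martingale to a sum that stays within bounded
  distance of it.\<close>

lemma second_moment_perturb:
  fixes X Y :: "'a \<Rightarrow> real"
  assumes int: "integrable M (\<lambda>w. (Y w)\<^sup>2)" and close: "AE w in M. \<bar>X w - Y w\<bar> \<le> D"
  shows "expectation (\<lambda>w. (X w)\<^sup>2) \<le> 2 * expectation (\<lambda>w. (Y w)\<^sup>2) + 2 * D\<^sup>2"
proof -
  have "expectation (\<lambda>w. (X w)\<^sup>2) \<le> expectation (\<lambda>w. 2 * (Y w)\<^sup>2 + 2 * D\<^sup>2)"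
  proof (rule integral_mono_AE')
    show "AE w in M. (X w)\<^sup>2 \<le> 2 * (Y w)\<^sup>2 + 2 * D\<^sup>2"
      using close
    proof eventually_elim
      case (elim w)
      have "(X w)\<^sup>2 = (Y w + (X w - Y w))\<^sup>2" by simp
      also have "\<dots> \<le> 2 * (Y w)\<^sup>2 + 2 * (X w - Y w)\<^sup>2"
        using sum_squares_ge_zero[of "Y w - (X w - Y w)" 0]
        by (simp add: power2_eq_square algebra_simps)
      also have "(X w - Y w)\<^sup>2 \<le> D\<^sup>2" using elim by (simp add: abs_le_square_iff[symmetric])
      finally show ?case by simp
    qed
  qed (use int in auto)
  then show ?thesis using int by (simp add: prob_space)
qed

end

section \<open>Finite-state Markov processes\<close>

text \<open>\<open>trans\<close> depends on time because the first iteration of the algorithm always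
  updates. The law is prescribed on paths inside \<open>S\<close> only; as the masses sum to one,
  leaving \<open>S\<close> turns out to be a null event.\<close>

locale finite_markov_process = prob_space M
  for M :: "'w measure" +
  fixes Z :: "nat \<Rightarrow> 'w \<Rightarrow> 's" and S :: "'s set"
    and init :: "'s \<Rightarrow> real" and trans :: "nat \<Rightarrow> 's \<Rightarrow> 's \<Rightarrow> real"
  assumes Z_measurable [measurable]: "\<And>t. Z t \<in> M \<rightarrow>\<^sub>M count_space UNIV"
    and finite_S: "finite S"
    and sum_init: "(\<Sum>a\<in>S. init a) = 1"
    and sum_trans: "\<And>t a. a \<in> S \<Longrightarrow> (\<Sum>b\<in>S. trans t a b) = 1"
    and law: "\<And>n z. (\<And>t. t \<le> n \<Longrightarrow> z t \<in> S) \<Longrightarrow>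
      prob {w \<in> space M. \<forall>t\<le>n. Z t w = z t} = init (z 0) * (\<Prod>t<n. trans t (z t) (z (Suc t)))"
begin

definition cyl :: "nat \<Rightarrow> (nat \<Rightarrow> 's) \<Rightarrow> 'w set" where
  "cyl n z = {w \<in> space M. \<forall>t\<le>n. Z t w = z t}"

text \<open>Extensional functions make this set finite and give each trajectory in \<open>S\<close>
  exactly one representative.\<close>

definition paths :: "nat \<Rightarrow> (nat \<Rightarrow> 's) set" where
  "paths n = (\<Pi>\<^sub>E t\<in>{..n}. S)"

lemma finite_paths: "finite (paths n)"
  unfolding paths_def by (intro finite_PiE finite_S) auto

lemma pathsD: "z \<in> paths n \<Longrightarrow> t \<le> n \<Longrightarrow> z t \<in> S"
  by (auto simp: paths_def)

lemma cyl_measurable [measurable]: "cyl n z \<in> events"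
proof -
  have "cyl n z = (\<Inter>t\<in>{..n}. Z t -` {z t} \<inter> space M)"
    by (auto simp: cyl_def)
  also have "\<dots> \<in> events"
    by (intro sets.finite_INT measurable_sets[OF Z_measurable]) auto
  finally show ?thesis .
qed

lemma cyl_Suc: "w \<in> cyl (Suc n) (z(Suc n := b)) \<longleftrightarrow> w \<in> cyl n z \<and> Z (Suc n) w = b"
  by (auto simp: cyl_def le_Suc_eq)

lemma prob_cyl_Suc:
  assumes "z \<in> paths n" "b \<in> S"
  shows "prob (cyl (Suc n) (z(Suc n := b))) = prob (cyl n z) * trans n (z n) b"
proof -
  have "prob (cyl (Suc n) (z(Suc n := b))) = init (z 0) *
     (\<Prod>t<Suc n. trans t ((z(Suc n := b)) t) ((z(Suc n := b)) (Suc t)))"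
    unfolding cyl_def using assms pathsD[OF assms(1)] by (subst law) (auto simp: le_Suc_eq)
  also have "\<dots> = init (z 0) * (\<Prod>t<n. trans t (z t) (z (Suc t))) * trans n (z n) b"
    by simp
  also have "init (z 0) * (\<Prod>t<n. trans t (z t) (z (Suc t))) = prob (cyl n z)"
    unfolding cyl_def using pathsD[OF assms(1)] by (subst law) auto
  finally show ?thesis .
qed

lemma AE_init: "AE w in M. Z 0 w \<in> S"
proof -
  have "prob {w \<in> space M. Z 0 w \<in> S} = prob (\<Union>a\<in>S. {w \<in> space M. Z 0 w = a})"
    by (rule arg_cong[where f = prob]) auto
  also have "\<dots> = (\<Sum>a\<in>S. prob {w \<in> space M. Z 0 w = a})"
    by (rule finite_measure_finite_Union) (auto simp: disjoint_family_on_def finite_S)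
  also have "\<dots> = (\<Sum>a\<in>S. init a)"
    using law[of 0 "\<lambda>_. _"] by (intro sum.cong refl) auto
  finally have "prob {w \<in> space M. Z 0 w \<in> S} = 1" using sum_init by simp
  then show ?thesis using measurable_sets[OF Z_measurable[of 0], of S]
    by (subst (asm) prob_Collect_eq_1) (auto simp: vimage_def Int_def conj_commute)
qed

text \<open>The extensions of the cylinder by a state of \<open>S\<close> are disjoint and, since
  the transition probabilities sum to one, already carry its whole probability.\<close>

lemma AE_cyl_step:
  assumes z: "z \<in> paths n"
  shows "AE w in M. w \<in> cyl n z \<longrightarrow> Z (Suc n) w \<in> S"
proof -
  let ?U = "\<Union>b\<in>S. cyl (Suc n) (z(Suc n := b))"
  have "prob ?U = (\<Sum>b\<in>S. prob (cyl (Suc n) (z(Suc n := b))))"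
    by (rule finite_measure_finite_Union) (auto simp: disjoint_family_on_def finite_S cyl_Suc)
  also have "\<dots> = prob (cyl n z)"
    using prob_cyl_Suc[OF z] sum_trans[OF pathsD[OF z order_refl]]
    by (simp add: sum_distrib_left[symmetric])
  finally have "prob (cyl n z - ?U) = 0"
    using finite_S by (subst finite_measure_Diff) (auto simp: cyl_Suc)
  then have "AE w in M. w \<notin> cyl n z - ?U"
    by (subst (asm) prob_eq_0) (rule sets.Diff sets.finite_UN finite_S cyl_measurable)+
  then show ?thesis by eventually_elim (auto simp: cyl_Suc)
qed

lemma path_in_paths: "(\<And>t. t \<le> n \<Longrightarrow> Z t w \<in> S) \<Longrightarrow> restrict (\<lambda>t. Z t w) {..n} \<in> paths n"
  by (auto simp: paths_def)

lemma path_in_cyl: "w \<in> space M \<Longrightarrow> w \<in> cyl n (restrict (\<lambda>t. Z t w) {..n})"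
  by (auto simp: cyl_def)

lemma AE_in_S: "AE w in M. \<forall>t. Z t w \<in> S"
proof -
  have "AE w in M. \<forall>t\<le>n. Z t w \<in> S" for n
  proof (induction n)
    case 0
    then show ?case using AE_init by simp
  next
    case (Suc n)
    have "AE w in M. \<forall>z\<in>paths n. w \<in> cyl n z \<longrightarrow> Z (Suc n) w \<in> S"
      using finite_paths AE_cyl_step by (intro AE_finite_allI) auto
    with Suc show ?case
      using AE_space
    proof eventually_elim
      case (elim w)
      then have "Z (Suc n) w \<in> S"
        using path_in_paths[of n w] path_in_cyl[of w n] by blast
      with elim show ?case by (auto simp: le_Suc_eq)
    qed
  qed
  then have "AE w in M. \<forall>n. \<forall>t\<le>n. Z t w \<in> S" by (simp add: AE_all_countable)
  then show ?thesis by eventually_elim auto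
qed

text \<open>Each time has only finitely many cylinders ending in an impossible transition, all of
  them null. This turns zeros of the kernel into pathwise facts.\<close>

lemma AE_trans_nonzero: "AE w in M. \<forall>t. trans t (Z t w) (Z (Suc t) w) \<noteq> 0"
  unfolding AE_all_countable
proof
  fix n
  have "AE w in M. w \<notin> cyl (Suc n) (z(Suc n := b))"
    if "z \<in> paths n" "b \<in> S" "trans n (z n) b = 0" for z b
    using prob_cyl_Suc[OF that(1,2)] that(3) by (subst prob_eq_0[symmetric]) auto
  then have "AE w in M. \<forall>zb\<in>paths n \<times> S. trans n (fst zb n) (snd zb) = 0 \<longrightarrow>
      w \<notin> cyl (Suc n) ((fst zb)(Suc n := snd zb))"
    using finite_paths finite_S by (intro AE_finite_allI AE_impI) auto
  with AE_in_S AE_space show "AE w in M. trans n (Z n w) (Z (Suc n) w) \<noteq> 0"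
  proof eventually_elim
    case (elim w)
    define z where "z = restrict (\<lambda>t. Z t w) {..n}"
    have "z \<in> paths n" "w \<in> cyl n z" "z n = Z n w"
      using elim(1,2) path_in_paths[of n w] path_in_cyl[of w n] by (simp_all add: z_def)
    then show ?case
      using elim(1) bspec[OF elim(3), of "(z, Z (Suc n) w)"] by (simp add: cyl_Suc)
  qed
qed

text \<open>The Markov property in integrated form, serving in place of a conditional expectation:
  the cylinder is split according to the next state.\<close>

lemma expectation_cyl_step:
  assumes z: "z \<in> paths n" and [measurable]: "(\<lambda>w. d (Z n w) (Z (Suc n) w)) \<in> borel_measurable M"
  shows "expectation (\<lambda>w. indicator (cyl n z) w * d (Z n w) (Z (Suc n) w))
    = prob (cyl n z) * (\<Sum>b\<in>S. trans n (z n) b * d (z n) b :: real)"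
proof -
  have "expectation (\<lambda>w. indicator (cyl n z) w * d (Z n w) (Z (Suc n) w))
    = expectation (\<lambda>w. \<Sum>b\<in>S. indicator (cyl (Suc n) (z(Suc n := b))) w * d (z n) b)"
  proof (rule integral_cong_AE)
    show "AE w in M. indicator (cyl n z) w * d (Z n w) (Z (Suc n) w)
      = (\<Sum>b\<in>S. indicator (cyl (Suc n) (z(Suc n := b))) w * d (z n) b)"
      using AE_in_S
    proof eventually_elim
      case (elim w)
      have "(\<Sum>b\<in>S. indicator (cyl (Suc n) (z(Suc n := b))) w * d (z n) b)
          = (\<Sum>b\<in>S. if b = Z (Suc n) w then indicator (cyl n z) w * d (z n) b else 0)"
        by (intro sum.cong refl) (auto simp: indicator_def cyl_Suc)
      also have "\<dots> = indicator (cyl n z) w * d (z n) (Z (Suc n) w)"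
        using elim by (simp add: finite_S)
      finally show ?case by (auto simp: indicator_def cyl_def)
    qed
  qed measurable
  also have "\<dots> = (\<Sum>b\<in>S. prob (cyl (Suc n) (z(Suc n := b))) * d (z n) b)"
    by (subst Bochner_Integration.integral_sum) (auto simp: emeasure_eq_measure)
  also have "\<dots> = prob (cyl n z) * (\<Sum>b\<in>S. trans n (z n) b * d (z n) b)"
    using prob_cyl_Suc[OF z] by (simp add: sum_distrib_left mult.assoc)
  finally show ?thesis .
qed

text \<open>The path space splits into finitely many cylinders. On each of them \<open>m\<close> is
  constant and \<open>d\<close> integrates to zero by the one-step formula.\<close>

lemma martingale_difference_orthogonal:
  fixes m :: "(nat \<Rightarrow> 's) \<Rightarrow> real"
  assumes adapted: "\<And>z z'. (\<And>t. t \<le> n \<Longrightarrow> z t = z' t) \<Longrightarrow> m z = m z'"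
    and [measurable]: "(\<lambda>w. m (\<lambda>t. Z t w)) \<in> borel_measurable M"
      "(\<lambda>w. d (Z n w) (Z (Suc n) w)) \<in> borel_measurable M"
    and bound: "\<And>a b. a \<in> S \<Longrightarrow> b \<in> S \<Longrightarrow> \<bar>d a b\<bar> \<le> C"
    and centred: "\<And>a. a \<in> S \<Longrightarrow> (\<Sum>b\<in>S. trans n a b * d a b) = 0"
  shows "expectation (\<lambda>w. m (\<lambda>t. Z t w) * d (Z n w) (Z (Suc n) w)) = 0"
proof -
  have "expectation (\<lambda>w. m (\<lambda>t. Z t w) * d (Z n w) (Z (Suc n) w))
    = expectation (\<lambda>w. \<Sum>z\<in>paths n. m z * (indicator (cyl n z) w * d (Z n w) (Z (Suc n) w)))"
  proof (rule integral_cong_AE)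
    show "AE w in M. m (\<lambda>t. Z t w) * d (Z n w) (Z (Suc n) w)
      = (\<Sum>z\<in>paths n. m z * (indicator (cyl n z) w * d (Z n w) (Z (Suc n) w)))"
      using AE_in_S AE_space
    proof eventually_elim
      case (elim w)
      define z0 where "z0 = restrict (\<lambda>t. Z t w) {..n}"
      have z0: "z0 \<in> paths n" "w \<in> cyl n z0"
        using elim path_in_paths[of n w] path_in_cyl[of w n] by (simp_all add: z0_def)
      \<comment> \<open>A trajectory lies in exactly one cylinder over \<open>paths n\<close>, so a
        single summand survives.\<close>
      have "z = z0" if "z \<in> paths n" "w \<in> cyl n z" for z
        using that(1) z0(1) unfolding paths_def
        by (rule PiE_ext) (use that(2) z0(2) in \<open>simp add: cyl_def\<close>)
      then have "(indicator (cyl n z) w :: real) = (if z = z0 then 1 else 0)" if "z \<in> paths n" for z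
        using that z0(2) by (metis indicator_simps)
      then have "(\<Sum>z\<in>paths n. m z * (indicator (cyl n z) w * d (Z n w) (Z (Suc n) w)))
          = (\<Sum>z\<in>paths n. if z = z0 then m z * d (Z n w) (Z (Suc n) w) else 0)"
        by (intro sum.cong refl) simp
      also have "\<dots> = m z0 * d (Z n w) (Z (Suc n) w)"
        using z0 by (simp add: finite_paths)
      also have "m z0 = m (\<lambda>t. Z t w)"
        by (rule adapted) (simp add: z0_def)
      finally show ?case by simp
    qed
  qed measurable
  also have "\<dots> = (\<Sum>z\<in>paths n. m z * expectation (\<lambda>w. indicator (cyl n z) w * d (Z n w) (Z (Suc n) w)))"
  proof (subst Bochner_Integration.integral_sum)
    fix z assume "z \<in> paths n"
    have "integrable M (\<lambda>w. indicator (cyl n z) w * d (Z n w) (Z (Suc n) w))"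
    proof (rule integrable_const_bound[where B = C])
      show "AE w in M. norm (indicator (cyl n z) w * d (Z n w) (Z (Suc n) w)) \<le> C"
        using AE_in_S
      proof eventually_elim
        case (elim w)
        then have "\<bar>d (Z n w) (Z (Suc n) w)\<bar> \<le> C" by (intro bound) auto
        then show ?case by (auto simp: indicator_def)
      qed
    qed measurable
    then show "integrable M (\<lambda>w. m z * (indicator (cyl n z) w * d (Z n w) (Z (Suc n) w)))"
      by simp
  qed simp
  also have "\<dots> = 0"
    using expectation_cyl_step centred pathsD by (intro sum.neutral) auto
  finally show ?thesis .
qed

context
  fixes d :: "nat \<Rightarrow> 's \<Rightarrow> 's \<Rightarrow> real" and C :: real
  assumes d_measurable [measurable]: "\<And>t. (\<lambda>w. d t (Z t w) (Z (Suc t) w)) \<in> borel_measurable M"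
    and d_bound: "\<And>t a b. a \<in> S \<Longrightarrow> b \<in> S \<Longrightarrow> \<bar>d t a b\<bar> \<le> C"
begin

lemma martingale_bound: "AE w in M. \<bar>\<Sum>t<n. d t (Z t w) (Z (Suc t) w)\<bar> \<le> real n * C"
  using AE_in_S
proof eventually_elim
  case (elim w)
  have "\<bar>\<Sum>t<n. d t (Z t w) (Z (Suc t) w)\<bar> \<le> (\<Sum>t<n. \<bar>d t (Z t w) (Z (Suc t) w)\<bar>)"
    by (rule sum_abs)
  also have "\<dots> \<le> (\<Sum>t<n. C)" using elim by (intro sum_mono d_bound) auto
  finally show ?case by simp
qed

lemma martingale_square_integrable: "integrable M (\<lambda>w. (\<Sum>t<n. d t (Z t w) (Z (Suc t) w))\<^sup>2)"
proof (rule integrable_const_bound[where B = "(real n * C)\<^sup>2"])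
  show "AE w in M. norm ((\<Sum>t<n. d t (Z t w) (Z (Suc t) w))\<^sup>2) \<le> (real n * C)\<^sup>2"
    using martingale_bound[of n] by eventually_elim (simp add: abs_le_square_iff[symmetric])
qed measurable

text \<open>The past sum is orthogonal to the next increment, so each step adds at most the square
  of \<open>C\<close>.\<close>

lemma martingale_second_moment:
  assumes centred: "\<And>t a. a \<in> S \<Longrightarrow> (\<Sum>b\<in>S. trans t a b * d t a b) = 0"
  shows "expectation (\<lambda>w. (\<Sum>t<n. d t (Z t w) (Z (Suc t) w))\<^sup>2) \<le> C\<^sup>2 * real n"
proof (induction n)
  case (Suc n)
  define A D where "A w = (\<Sum>t<n. d t (Z t w) (Z (Suc t) w))" and "D w = d n (Z n w) (Z (Suc n) w)" for w
  have [measurable]: "A \<in> borel_measurable M" "D \<in> borel_measurable M"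
    unfolding A_def D_def by measurable
  have D_bound: "AE w in M. \<bar>D w\<bar> \<le> C"
    using AE_in_S by eventually_elim (auto simp: D_def intro: d_bound)
  have A_bound: "AE w in M. \<bar>A w\<bar> \<le> real n * C"
    unfolding A_def by (rule martingale_bound)
  have int_A: "integrable M (\<lambda>w. (A w)\<^sup>2)"
    unfolding A_def by (rule martingale_square_integrable)
  have D_sq: "AE w in M. (D w)\<^sup>2 \<le> C\<^sup>2"
    using D_bound by eventually_elim (simp add: abs_le_square_iff[symmetric])
  have int_D: "integrable M (\<lambda>w. (D w)\<^sup>2)"
    by (rule integrable_const_bound[where B = "C\<^sup>2"]) (use D_sq in simp, measurable)
  have int_AD: "integrable M (\<lambda>w. A w * D w)"
  proof (rule integrable_const_bound[where B = "real n * C * C"])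
    show "AE w in M. norm (A w * D w) \<le> real n * C * C"
      using A_bound D_bound by eventually_elim (auto simp: abs_mult intro!: mult_mono)
  qed measurable
  have "expectation (\<lambda>w. A w * D w) = 0"
    unfolding A_def D_def
    by (rule martingale_difference_orthogonal[where m = "\<lambda>z. \<Sum>t<n. d t (z t) (z (Suc t))" and d = "d n"])
       (use d_bound centred in \<open>auto intro!: sum.cong\<close>)
  moreover have "expectation (\<lambda>w. (D w)\<^sup>2) \<le> C\<^sup>2"
    by (rule integral_le_const[OF int_D D_sq])
  moreover have "expectation (\<lambda>w. (A w + D w)\<^sup>2) =
      expectation (\<lambda>w. (A w)\<^sup>2) + expectation (\<lambda>w. (D w)\<^sup>2) + 2 * expectation (\<lambda>w. A w * D w)"
    using int_A int_D int_AD by (simp add: power2_sum mult.assoc)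
  ultimately have "expectation (\<lambda>w. (A w + D w)\<^sup>2) \<le> C\<^sup>2 * real n + C\<^sup>2"
    using Suc by (simp add: A_def)
  then show ?case by (simp add: A_def D_def algebra_simps)
qed simp

end

end

section \<open>The Poisson equation on the hypercube\<close>

lemma flip_flip [simp]: "flip (flip g j) j = g"
  by (auto simp: flip_def)

lemma flip_Diff [simp]: "flip g j - {j} = g - {j}"
  by (auto simp: flip_def)

lemma flip_subset: "g \<subseteq> {..<P} \<Longrightarrow> j < P \<Longrightarrow> flip g j \<subseteq> {..<P}"
  by (auto simp: flip_def)

lemma sum_flip:
  assumes "j < P"
  shows "(\<Sum>g\<in>Pow {..<P}. F (flip g j)) = (\<Sum>g\<in>Pow {..<P}. F g)"
  by (rule sum.reindex_bij_witness[where i = "\<lambda>g. flip g j" and j = "\<lambda>g. flip g j"])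
     (use assms flip_subset in auto)

text \<open>With \<open>r = \<epsilon> / 2\<close>, where \<open>\<epsilon>\<close> bounds all flip probabilities from below, the function
  \<open>1 - r ^ card g\<close> contracts strictly under one step of the walk from a nonempty set: some
  element is removed with probability at least \<open>2 * r\<close>, and the function never exceeds \<open>1\<close>.
  This makes the Green series of the walk killed at the empty set converge.\<close>

lemma killed_Poisson_equation:
  fixes f :: "nat set \<Rightarrow> nat \<Rightarrow> real" and psi :: "nat set \<Rightarrow> real"
  assumes f_pos: "\<And>g j. g \<subseteq> {..<P} \<Longrightarrow> j < P \<Longrightarrow> 0 < f g j"
    and f_sum: "\<And>g. g \<subseteq> {..<P} \<Longrightarrow> (\<Sum>j<P. f g j) = 1"
  obtains u where
    "\<And>g. g \<subseteq> {..<P} \<Longrightarrow> g \<noteq> {} \<Longrightarrow> u g = psi g + (\<Sum>j<P. f g j * u (flip g j))"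
proof -
  \<comment> \<open>The inserted \<open>1\<close> keeps the set nonempty when \<open>P = 0\<close>
    and ensures \<open>eps \<le> 1\<close>.\<close>
  define eps where "eps = Min (insert 1 ((\<lambda>(g, j). f g j) ` (Pow {..<P} \<times> {..<P})))"
  have eps: "0 < eps" "eps \<le> 1" "\<And>g j. g \<subseteq> {..<P} \<Longrightarrow> j < P \<Longrightarrow> eps \<le> f g j"
    unfolding eps_def using f_pos by (auto intro!: Min_le)
  define r where "r = eps / 2"
  have r: "0 < r" "r < 1" "2 * r \<le> 1" using eps by (auto simp: r_def)
  define V where "V g = 1 - r ^ card g" for g :: "nat set"
  have V_bounds: "0 \<le> V g" "V g \<le> 1" for g
    using r by (auto simp: V_def power_le_one)
  \<comment> \<open>The contraction factor: since \<open>V\<close> is at most \<open>1\<close>, the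
    additive decrease \<open>r ^ card g\<close> is at least \<open>r ^ P * V g\<close>.\<close>
  define lam where "lam = 1 - r ^ P"
  have lam: "0 \<le> lam" "lam < 1" using r by (auto simp: lam_def power_le_one)
  have drift: "(\<Sum>j<P. f g j * V (flip g j)) \<le> lam * V g" if g: "g \<subseteq> {..<P}" "g \<noteq> {}" for g
  proof -
    obtain k where k: "k \<in> g" using g by auto
    then have kP: "k < P" using g by auto
    have fin: "finite g" using g finite_subset by auto
    obtain m where m: "card g = Suc m" using k fin by (metis card_Suc_Diff1)
    \<comment> \<open>Flipping \<open>k\<close> lowers the cardinality to \<open>m\<close>, while
      all other flips are bounded by \<open>V \<le> 1\<close>. This gains
      \<open>f g k * r ^ m\<close>, at least twice \<open>r ^ card g\<close>.\<close>
    have Vk: "V (flip g k) = 1 - r ^ m"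
      using k fin m by (simp add: V_def flip_def)
    have "(\<Sum>j<P. f g j * V (flip g j)) = f g k * V (flip g k) + (\<Sum>j\<in>{..<P} - {k}. f g j * V (flip g j))"
      using kP by (subst sum.remove[of _ k]) auto
    also have "(\<Sum>j\<in>{..<P} - {k}. f g j * V (flip g j)) \<le> (\<Sum>j\<in>{..<P} - {k}. f g j * 1)"
      using f_pos[OF g(1)] V_bounds by (intro sum_mono mult_left_mono) (auto simp: less_imp_le)
    also have "\<dots> = 1 - f g k"
      using f_sum[OF g(1)] kP by (simp add: sum.remove[of _ k])
    finally have "(\<Sum>j<P. f g j * V (flip g j)) \<le> 1 - f g k * r ^ m"
      unfolding Vk by (simp add: algebra_simps)
    also have "\<dots> \<le> 1 - 2 * r * r ^ m"
      using eps(3)[OF g(1) kP] r by (simp add: r_def)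
    also have "\<dots> = V g - r ^ card g"
      by (simp add: V_def m)
    also have "\<dots> \<le> V g - r ^ P * V g"
    proof -
      have "r ^ P \<le> r ^ card g"
        using r g by (intro power_decreasing) (auto dest: card_mono[rotated])
      moreover have "r ^ P * V g \<le> r ^ P * 1"
        using r V_bounds by (intro mult_left_mono) auto
      ultimately show ?thesis by simp
    qed
    finally show ?thesis by (simp add: lam_def algebra_simps)
  qed
  \<comment> \<open>The terms of the Green series: \<open>v n g\<close> is the expectation of
    \<open>psi\<close> after \<open>n\<close> steps from \<open>g\<close>, restricted to walks that
    have avoided the empty set.\<close>
  define v where "v = rec_nat (\<lambda>g. if g = {} then 0 else psi g)
      (\<lambda>_ w g. if g = {} then 0 else (\<Sum>j<P. f g j * w (flip g j)))"
  have v_0: "v 0 g = (if g = {} then 0 else psi g)"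
    and v_Suc: "v (Suc n) g = (if g = {} then 0 else (\<Sum>j<P. f g j * v n (flip g j)))" for n g
    by (auto simp: v_def)
  define B where "B = Max ((\<lambda>g. \<bar>psi g\<bar>) ` Pow {..<P})"
  have B: "\<bar>psi g\<bar> \<le> B" if "g \<subseteq> {..<P}" for g
    unfolding B_def using that by (intro Max_ge) auto
  have B0: "0 \<le> B" using B[of "{}"] by simp
  \<comment> \<open>\<open>1 - r\<close> is a lower bound of \<open>V\<close> on nonempty sets, so
    \<open>C * V g\<close> dominates \<open>\<bar>psi g\<bar>\<close> there and starts the
    induction.\<close>
  define C where "C = B / (1 - r)"
  have v_bound: "\<bar>v n g\<bar> \<le> C * lam ^ n * V g" if "g \<subseteq> {..<P}" for n g
    using that
  proof (induction n arbitrary: g)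
    case 0
    show ?case
    proof (cases "g = {}")
      case False
      have "finite g" using 0 finite_subset by auto
      then have "1 \<le> card g" using False by (simp add: Suc_le_eq card_gt_0_iff)
      then have "r ^ card g \<le> r ^ 1" using r by (intro power_decreasing) auto
      then have "1 - r \<le> V g" by (simp add: V_def)
      then have "C * (1 - r) \<le> C * V g"
        using B0 r by (intro mult_left_mono) (auto simp: C_def)
      moreover have "C * (1 - r) = B" using r by (simp add: C_def)
      ultimately show ?thesis using B[OF 0] False by (simp add: v_0)
    qed (simp add: v_0 V_def)
  next
    case (Suc n)
    show ?case
    proof (cases "g = {}")
      case False
      have "\<bar>v (Suc n) g\<bar> \<le> (\<Sum>j<P. \<bar>f g j * v n (flip g j)\<bar>)"
        using False by (simp add: v_Suc)
      also have "\<dots> \<le> (\<Sum>j<P. f g j * (C * lam ^ n * V (flip g j)))"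
        using f_pos[OF Suc.prems] Suc.IH[OF flip_subset[OF Suc.prems]]
        by (intro sum_mono) (simp add: abs_mult less_imp_le mult_left_mono)
      also have "\<dots> = C * lam ^ n * (\<Sum>j<P. f g j * V (flip g j))"
        by (simp add: sum_distrib_left algebra_simps)
      also have "\<dots> \<le> C * lam ^ n * (lam * V g)"
        using drift[OF Suc.prems False] B0 r lam by (intro mult_left_mono) (auto simp: C_def)
      finally show ?thesis by (simp add: algebra_simps)
    qed (simp add: v_Suc V_def)
  qed
  have v_summable: "summable (\<lambda>n. v n g)" if "g \<subseteq> {..<P}" for g
  proof (rule summable_comparison_test')
    show "summable (\<lambda>n. C * V g * lam ^ n)"
      using lam by (intro summable_mult summable_geometric) auto
    show "norm (v n g) \<le> C * V g * lam ^ n" for n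
      using v_bound[OF that, of n] by (simp add: algebra_simps)
  qed
  define u where "u g = (\<Sum>n. v n g)" for g
  show ?thesis
  proof (rule that)
    fix g assume g: "g \<subseteq> {..<P}" "g \<noteq> {}"
    \<comment> \<open>Dropping the zeroth term shifts the series by one index, which is one step of
      the walk.\<close>
    have "u g = v 0 g + (\<Sum>n. v (Suc n) g)"
      using suminf_split_head[OF v_summable[OF g(1)]] by (simp add: u_def)
    also have "(\<Sum>n. v (Suc n) g) = (\<Sum>n. \<Sum>j<P. f g j * v n (flip g j))"
      using g by (simp add: v_Suc)
    also have "\<dots> = (\<Sum>j<P. f g j * u (flip g j))"
      unfolding u_def using v_summable flip_subset[OF g(1)]
      by (subst suminf_sum) (auto simp: suminf_mult intro!: summable_mult)
    finally show "u g = psi g + (\<Sum>j<P. f g j * u (flip g j))"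
      using g by (simp add: v_0)
  qed
qed

text \<open>Detailed balance moves the weight to the flipped set, and flipping a fixed coordinate
  permutes the subsets; hence \<open>mu\<close> is invariant.\<close>

lemma reversible_sum_flip:
  fixes f :: "nat set \<Rightarrow> nat \<Rightarrow> real"
  assumes f_sum: "\<And>g. g \<subseteq> {..<P} \<Longrightarrow> (\<Sum>j<P. f g j) = 1"
    and rev: "\<And>g j. g \<subseteq> {..<P} \<Longrightarrow> j < P \<Longrightarrow> mu g * f g j = mu (flip g j) * f (flip g j) j"
  shows "(\<Sum>g\<in>Pow {..<P}. mu g * (\<Sum>j<P. f g j * u (flip g j))) = (\<Sum>g\<in>Pow {..<P}. mu g * u g)"
proof -
  have "(\<Sum>g\<in>Pow {..<P}. mu g * (\<Sum>j<P. f g j * u (flip g j)))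
      = (\<Sum>j<P. \<Sum>g\<in>Pow {..<P}. mu g * f g j * u (flip g j))"
    by (subst sum.swap) (simp add: sum_distrib_left mult.assoc)
  also have "\<dots> = (\<Sum>j<P. \<Sum>g\<in>Pow {..<P}. mu (flip g j) * f (flip g j) j * u (flip g j))"
    using rev by (intro sum.cong refl) auto
  also have "\<dots> = (\<Sum>j<P. \<Sum>g\<in>Pow {..<P}. mu g * f g j * u g)"
    by (intro sum.cong refl sum_flip[where F = "\<lambda>g. mu g * f g _ * u g"]) auto
  also have "\<dots> = (\<Sum>g\<in>Pow {..<P}. mu g * (\<Sum>j<P. f g j) * u g)"
    by (subst sum.swap) (simp add: sum_distrib_left sum_distrib_right)
  also have "\<dots> = (\<Sum>g\<in>Pow {..<P}. mu g * u g)"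
    using f_sum by (intro sum.cong refl) auto
  finally show ?thesis .
qed

text \<open>The killed solution leaves a defect \<open>D\<close> at the empty set only. Invariance
  of \<open>mu\<close> and centring of \<open>psi\<close> make the total defect weighted by
  \<open>mu\<close> zero, so it vanishes there too.\<close>

lemma Poisson_equation:
  fixes f :: "nat set \<Rightarrow> nat \<Rightarrow> real" and psi mu :: "nat set \<Rightarrow> real"
  assumes f_pos: "\<And>g j. g \<subseteq> {..<P} \<Longrightarrow> j < P \<Longrightarrow> 0 < f g j"
    and f_sum: "\<And>g. g \<subseteq> {..<P} \<Longrightarrow> (\<Sum>j<P. f g j) = 1"
    and rev: "\<And>g j. g \<subseteq> {..<P} \<Longrightarrow> j < P \<Longrightarrow> mu g * f g j = mu (flip g j) * f (flip g j) j"
    and mu_0: "mu {} \<noteq> 0"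
    and centred: "(\<Sum>g\<in>Pow {..<P}. mu g * psi g) = 0"
  obtains u where "\<And>g. g \<subseteq> {..<P} \<Longrightarrow> u g = psi g + (\<Sum>j<P. f g j * u (flip g j))"
proof -
  obtain u where u: "\<And>g. g \<subseteq> {..<P} \<Longrightarrow> g \<noteq> {} \<Longrightarrow> u g = psi g + (\<Sum>j<P. f g j * u (flip g j))"
    by (rule killed_Poisson_equation[of P f psi]) (use f_pos f_sum in blast)+
  define D where "D g = u g - psi g - (\<Sum>j<P. f g j * u (flip g j))" for g
  have "(\<Sum>g\<in>Pow {..<P}. mu g * D g) = 0"
    using reversible_sum_flip[of P f mu u] f_sum rev centred
    by (simp add: D_def right_diff_distrib sum_subtractf)
  moreover have "(\<Sum>g\<in>Pow {..<P} - {{}}. mu g * D g) = 0"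
    using u by (intro sum.neutral) (auto simp: D_def)
  ultimately have "mu {} * D {} = 0"
    by (simp add: sum.remove[of "Pow {..<P}" "{}"])
  then have "D {} = 0" using mu_0 by simp
  then have "D g = 0" if "g \<subseteq> {..<P}" for g
    using u[OF that] by (cases "g = {}") (auto simp: D_def)
  then show ?thesis by (intro that[of u]) (auto simp: D_def algebra_simps)
qed

section \<open>The VC-wTGS estimator\<close>

locale wtgs_target =
  fixes P :: nat and pst :: "nat set \<Rightarrow> real"
  assumes P_pos: "0 < P"
    and pst_pos: "\<And>g. g \<subseteq> {..<P} \<Longrightarrow> 0 < pst g"
    and pst_sum: "(\<Sum>g\<in>Pow {..<P}. pst g) = 1"
begin

abbreviation eta :: "nat set \<Rightarrow> nat \<Rightarrow> real" where "eta \<equiv> cond_one pst"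
abbreviation phi :: "nat set \<Rightarrow> real" where "phi \<equiv> wphi P pst eta"
abbreviation sel :: "nat set \<Rightarrow> nat \<Rightarrow> real" where "sel \<equiv> fsel P pst eta"

lemma cond_cur_pos:
  assumes "g \<subseteq> {..<P}" "j < P"
  shows "0 < cond_cur pst g j"
  using pst_pos[OF assms(1)] pst_pos[OF flip_subset[OF assms]] by (simp add: cond_cur_def)

lemma cond_one_bounds:
  assumes "g \<subseteq> {..<P}" "j < P"
  shows "0 < eta (g - {j}) j" "eta (g - {j}) j \<le> 1"
proof -
  have "0 < pst (insert j g)" "0 < pst (g - {j})" using assms by (auto intro!: pst_pos)
  then show "0 < eta (g - {j}) j" "eta (g - {j}) j \<le> 1"
    by (simp_all add: cond_one_def divide_simps)
qed

lemma phi_pos: "g \<subseteq> {..<P} \<Longrightarrow> 0 < phi g"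
  unfolding wphi_def using P_pos cond_cur_pos cond_one_bounds(1) by (intro sum_pos) auto

lemma sel_pos: "g \<subseteq> {..<P} \<Longrightarrow> j < P \<Longrightarrow> 0 < sel g j"
  using phi_pos cond_cur_pos cond_one_bounds(1) by (simp add: fsel_def)

lemma sum_sel:
  assumes "g \<subseteq> {..<P}"
  shows "(\<Sum>j<P. sel g j) = 1"
proof -
  have "(\<Sum>j<P. sel g j) = (\<Sum>j<P. eta (g - {j}) j / 2 / cond_cur pst g j) / phi g"
    unfolding sum_divide_distrib by (intro sum.cong refl) (simp add: fsel_def)
  also have "\<dots> = phi g / phi g"
    by (simp only: wphi_def)
  finally show ?thesis using phi_pos[OF assms] by simp
qed

text \<open>Both \<open>phi\<close> and the conditional probability cancel. What remains is half of
  \<open>eta\<close> times the joint mass of \<open>g\<close> and its flip, which is symmetric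
  because \<open>eta\<close> sees only \<open>g - {j}\<close>.\<close>

lemma sel_reversible:
  assumes "g \<subseteq> {..<P}" "j < P"
  shows "pst g * phi g * sel g j = pst (flip g j) * phi (flip g j) * sel (flip g j) j"
proof -
  have "pst g' * phi g' * sel g' j = eta (g' - {j}) j / 2 * (pst g' + pst (flip g' j))"
    if "g' \<subseteq> {..<P}" for g'
    using phi_pos[OF that] pst_pos[OF that] pst_pos[OF flip_subset[OF that assms(2)]] assms(2)
    by (simp add: fsel_def cond_cur_def)
  from this[OF assms(1)] this[OF flip_subset[OF assms]] show ?thesis
    by (simp add: add.commute)
qed

text \<open>The tower property. Doubling the sum pairs \<open>g\<close> with its flip at
  \<open>i\<close>: both share the same \<open>eta\<close>, and their joint mass times
  \<open>eta\<close> is the mass of the member that contains \<open>i\<close>.\<close>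

lemma sum_pst_cond_one:
  assumes "i < P"
  shows "(\<Sum>g\<in>Pow {..<P}. pst g * eta (g - {i}) i) = PIP P pst i"
proof -
  define F where "F g = (if i \<in> g then pst g else 0)" for g
  let ?L = "\<Sum>g\<in>Pow {..<P}. pst g * eta (g - {i}) i"
  have "?L + ?L = (\<Sum>g\<in>Pow {..<P}. pst g * eta (g - {i}) i) +
      (\<Sum>g\<in>Pow {..<P}. pst (flip g i) * eta (flip g i - {i}) i)"
    by (simp add: sum_flip[OF assms, where F = "\<lambda>g. pst g * eta (g - {i}) i", symmetric])
  also have "\<dots> = (\<Sum>g\<in>Pow {..<P}. (pst g + pst (flip g i)) * eta (g - {i}) i)"
    by (simp add: sum.distrib[symmetric] algebra_simps)
  also have "\<dots> = (\<Sum>g\<in>Pow {..<P}. F g + F (flip g i))"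
  proof (intro sum.cong refl)
    fix g assume "g \<in> Pow {..<P}"
    then have "0 < pst (insert i g)" "0 < pst (g - {i})" using assms by (auto intro!: pst_pos)
    then show "(pst g + pst (flip g i)) * eta (g - {i}) i = F g + F (flip g i)"
      by (cases "i \<in> g") (auto simp: F_def flip_def cond_one_def insert_absorb add.commute)
  qed
  also have "\<dots> = (\<Sum>g\<in>Pow {..<P}. F g) + (\<Sum>g\<in>Pow {..<P}. F g)"
    by (simp add: sum.distrib sum_flip[OF assms])
  also have "(\<Sum>g\<in>Pow {..<P}. F g) = PIP P pst i"
    unfolding PIP_def F_def by (subst sum.inter_filter) auto
  finally show ?thesis by simp
qed

lemma PIP_bounds: "0 \<le> PIP P pst i" "PIP P pst i \<le> 1"
proof -
  show "0 \<le> PIP P pst i"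
    unfolding PIP_def using pst_pos by (intro sum_nonneg) (auto simp: less_imp_le)
  have "PIP P pst i \<le> (\<Sum>g\<in>Pow {..<P}. pst g)"
    unfolding PIP_def using pst_pos by (intro sum_mono2) (auto simp: less_imp_le)
  then show "PIP P pst i \<le> 1" by (simp add: pst_sum)
qed

definition psi :: "nat \<Rightarrow> nat set \<Rightarrow> real" where
  "psi i g = (eta (g - {i}) i - PIP P pst i) / phi g"

lemma psi_bound:
  obtains C where "\<And>g. g \<subseteq> {..<P} \<Longrightarrow> \<bar>psi i g\<bar> \<le> C"
proof
  show "\<bar>psi i g\<bar> \<le> Max ((\<lambda>g. \<bar>psi i g\<bar>) ` Pow {..<P})" if "g \<subseteq> {..<P}" for g
    using that by (intro Max_ge) auto
qed

text \<open>The factor \<open>phi\<close> in the stationary weight cancels the denominator of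
  \<open>psi\<close>, which leaves the tower property minus \<open>PIP\<close>.\<close>

lemma sum_psi_eq_0:
  assumes "i < P"
  shows "(\<Sum>g\<in>Pow {..<P}. (pst g * phi g) * psi i g) = 0"
proof -
  have "(\<Sum>g\<in>Pow {..<P}. (pst g * phi g) * psi i g)
      = (\<Sum>g\<in>Pow {..<P}. pst g * eta (g - {i}) i - PIP P pst i * pst g)"
  proof (intro sum.cong refl)
    fix g assume "g \<in> Pow {..<P}"
    then have "phi g \<noteq> 0" using phi_pos[of g] by simp
    then show "(pst g * phi g) * psi i g = pst g * eta (g - {i}) i - PIP P pst i * pst g"
      by (simp add: psi_def field_simps)
  qed
  also have "\<dots> = 0"
    by (simp add: sum_subtractf sum_pst_cond_one[OF assms] sum_distrib_left[symmetric] pst_sum)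
  finally show ?thesis .
qed

lemma psi_Poisson:
  assumes "i < P"
  obtains u where "\<And>g. g \<subseteq> {..<P} \<Longrightarrow> u g = psi i g + (\<Sum>j<P. sel g j * u (flip g j))"
proof (rule Poisson_equation[of P sel "\<lambda>g. pst g * phi g" "psi i"])
  show "pst {} * phi {} \<noteq> 0" using pst_pos[of "{}"] phi_pos[of "{}"] by simp
qed (use sel_pos sum_sel sel_reversible sum_psi_eq_0[OF assms] that in auto)

end

section \<open>The run as a finite Markov process\<close>

locale vc_wtgs_run = wtgs_target P pst + prob_space M
  for P :: nat and pst :: "nat set \<Rightarrow> real" and M :: "'w measure" +
  fixes S :: nat and h :: real and G :: "nat \<Rightarrow> 'w \<Rightarrow> nat set" and Q :: "nat \<Rightarrow> 'w \<Rightarrow> bool"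
  assumes S: "1 \<le> S" "S \<le> P"
    and run: "is_vc_wtgs_run M P S h pst (cond_one pst) G Q"
begin

definition alpha :: real where "alpha = real S / real P"

lemma alpha_bounds: "0 < alpha" "alpha \<le> 1"
  using S P_pos by (auto simp: alpha_def)

abbreviation vtrans :: "nat \<Rightarrow> nat set \<Rightarrow> bool \<Rightarrow> nat set \<Rightarrow> real" where
  "vtrans \<equiv> vc_trans P S pst eta"

lemma G_measurable: "G t \<in> M \<rightarrow>\<^sub>M count_space UNIV"
  and Q_measurable [measurable]: "Q t \<in> M \<rightarrow>\<^sub>M count_space UNIV"
  using run by (auto simp: is_vc_wtgs_run_def)

lemma fun_G_measurable [measurable]: "(\<lambda>w. F (G t w) :: real) \<in> borel_measurable M"
  using measurable_compose[OF G_measurable, of F borel] by simp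

text \<open>The one-step expectation of a function of the next state and flag. It yields the
  normalisation of the kernel and the centring of both martingales.\<close>

lemma sum_vtrans:
  assumes "a \<subseteq> {..<P}"
  shows "(\<Sum>(b, q)\<in>Pow {..<P} \<times> UNIV. vtrans t a q b * F b q)
    = (if t = 1 then 1 else alpha) * (\<Sum>j<P. sel a j * F (flip a j) True)
      + (if t = 1 then 0 else 1 - alpha) * F a False"
proof -
  \<comment> \<open>The probability of an update at iteration \<open>t\<close>.\<close>
  define c where "c = (if t = 1 then 1 else alpha)"
  have "(\<Sum>(b, q)\<in>Pow {..<P} \<times> UNIV. vtrans t a q b * F b q)
      = (\<Sum>b\<in>Pow {..<P}. c * (\<Sum>j<P. if b = flip a j then sel a j else 0) * F b True)
      + (\<Sum>b\<in>Pow {..<P}. (1 - c) * (if b = a then 1 else 0) * F b False)"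
    by (simp add: sum.cartesian_product[symmetric] UNIV_bool sum.distrib vc_trans_def c_def alpha_def
        add.commute)
  also have "(\<Sum>b\<in>Pow {..<P}. c * (\<Sum>j<P. if b = flip a j then sel a j else 0) * F b True)
      = (\<Sum>b\<in>Pow {..<P}. \<Sum>j<P. if b = flip a j then c * sel a j * F b True else 0)"
    by (simp add: sum_distrib_left sum_distrib_right if_distrib if_distribR cong: if_cong)
  also have "\<dots> = (\<Sum>j<P. \<Sum>b\<in>Pow {..<P}. if b = flip a j then c * sel a j * F b True else 0)"
    by (rule sum.swap)
  also have "\<dots> = (\<Sum>j<P. c * sel a j * F (flip a j) True)"
    using flip_subset[OF assms] by (intro sum.cong refl) (subst sum.delta, auto)
  also have "(\<Sum>b\<in>Pow {..<P}. (1 - c) * (if b = a then 1 else 0) * F b False)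
      = (\<Sum>b\<in>Pow {..<P}. if b = a then (1 - c) * F b False else 0)"
    by (intro sum.cong refl) auto
  also have "\<dots> = (1 - c) * F a False"
    using assms by (subst sum.delta) auto
  finally show ?thesis by (simp add: c_def sum_distrib_left mult.assoc)
qed

text \<open>\<open>Q 0\<close> plays no role in a run, so it is replaced by \<open>True\<close>.\<close>

definition Z :: "nat \<Rightarrow> 'w \<Rightarrow> nat set \<times> bool" where
  "Z t w = (G t w, t = 0 \<or> Q t w)"

text \<open>The flag belongs to the state so that the law of a run is a product of transitions; the
  step from time \<open>t\<close> is iteration \<open>Suc t\<close> of the algorithm.\<close>

sublocale Z: finite_markov_process M Z "Pow {..<P} \<times> UNIV"
  "\<lambda>(g, q). if q then gamma_prior P h g else 0"
  "\<lambda>t (a, _) (b, q). vtrans (Suc t) a q b"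
proof
  show "Z t \<in> M \<rightarrow>\<^sub>M count_space UNIV" for t
  proof -
    have "(\<lambda>w. (G t w, q)) \<in> M \<rightarrow>\<^sub>M count_space UNIV" for q :: bool
      by (rule measurable_compose[OF G_measurable]) simp
    moreover have "(\<lambda>w. t = 0 \<or> Q t w) \<in> M \<rightarrow>\<^sub>M count_space UNIV"
      by measurable
    ultimately show ?thesis
      unfolding Z_def[abs_def]
      by (rule measurable_compose_countable[where f = "\<lambda>q w. (G t w, q)"])
  qed
  show "finite (Pow {..<P} \<times> (UNIV :: bool set))" by simp
  show "(\<Sum>a\<in>Pow {..<P} \<times> UNIV. (\<lambda>(g, q). if q then gamma_prior P h g else 0) a) = 1"
    by (simp add: sum.cartesian_product[symmetric] UNIV_bool sum_gamma_prior)
  show "(\<Sum>b\<in>Pow {..<P} \<times> UNIV. (\<lambda>(a, _) (b, q). vtrans (Suc t) a q b) a b) = 1"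
    if "a \<in> Pow {..<P} \<times> UNIV" for t and a :: "nat set \<times> bool"
    using that sum_vtrans[of "fst a" "Suc t" "\<lambda>_ _. 1"] sum_sel
    by (cases a) (auto split: if_splits)
next
  fix n and z :: "nat \<Rightarrow> nat set \<times> bool"
  show "prob {w \<in> space M. \<forall>t\<le>n. Z t w = z t} =
      (\<lambda>(g, q). if q then gamma_prior P h g else 0) (z 0) *
      (\<Prod>t<n. (\<lambda>(a, _) (b, q). vtrans (Suc t) a q b) (z t) (z (Suc t)))"
  proof (cases "snd (z 0)")
    case True
    have "{w \<in> space M. \<forall>t\<le>n. Z t w = z t} =
        {w \<in> space M. (\<forall>t\<le>n. G t w = fst (z t)) \<and> (\<forall>t\<in>{1..n}. Q t w = snd (z t))}"
    proof -
      have "(\<forall>t\<le>n. Z t w = z t) \<longleftrightarrow> (\<forall>t\<le>n. G t w = fst (z t)) \<and> (\<forall>t\<in>{1..n}. Q t w = snd (z t))" for w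
      proof -
        have "Z t w = z t \<longleftrightarrow> G t w = fst (z t) \<and> (t \<in> {1..n} \<longrightarrow> Q t w = snd (z t))" if "t \<le> n" for t
          using that True by (cases "t = 0") (auto simp: Z_def prod_eq_iff)
        then show ?thesis by auto
      qed
      then show ?thesis by simp
    qed
    also have "prob \<dots> = gamma_prior P h (fst (z 0)) *
        (\<Prod>t\<in>{1..n}. vtrans t (fst (z (t - 1))) (snd (z t)) (fst (z t)))"
      using run by (simp add: is_vc_wtgs_run_def)
    also have "(\<Prod>t\<in>{1..n}. vtrans t (fst (z (t - 1))) (snd (z t)) (fst (z t)))
        = (\<Prod>t<n. vtrans (Suc t) (fst (z t)) (snd (z (Suc t))) (fst (z (Suc t))))"
      by (simp add: prod.atLeast1_atMost_eq)
    finally show ?thesis using True by (simp add: case_prod_beta)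
  next
    case False
    \<comment> \<open>At time zero the flag of \<open>Z\<close> is always \<open>True\<close>, so
      here both sides vanish.\<close>
    then have "{w \<in> space M. \<forall>t\<le>n. Z t w = z t} = {}"
      by (auto simp: Z_def prod_eq_iff)
    then show ?thesis using False by (simp only: measure_empty) (simp add: case_prod_beta)
  qed
qed

text \<open>The kernel gives probability zero to a first iteration without update and to any move
  without update.\<close>

lemma AE_run:
  "AE w in M. (\<forall>t. G t w \<subseteq> {..<P}) \<and> Q 1 w \<and> (\<forall>t. \<not> Q (Suc t) w \<longrightarrow> G (Suc t) w = G t w)"
  using Z.AE_in_S Z.AE_trans_nonzero
proof eventually_elim
  case (elim w)
  then show ?case
    by (auto simp: Z_def vc_trans_def split: if_splits dest: spec[where x = 0])
qed

section \<open>Update count \<open>N\<close>, weight total \<open>W\<close> and error numerator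
  \<open>A\<close> over iterations \<open>1\<close> to \<open>T\<close>\<close>

definition N :: "nat \<Rightarrow> 'w \<Rightarrow> real" where
  "N T w = (\<Sum>t<T. if Q (Suc t) w then 1 else 0)"

definition W :: "nat \<Rightarrow> 'w \<Rightarrow> real" where
  "W T w = (\<Sum>t<T. if Q (Suc t) w then 1 / phi (G (Suc t) w) else 0)"

definition A :: "nat \<Rightarrow> nat \<Rightarrow> 'w \<Rightarrow> real" where
  "A i T w = (\<Sum>t<T. if Q (Suc t) w then psi i (G (Suc t) w) else 0)"

lemma A_second_moment:
  assumes "i < P"
  obtains K where "\<And>T. expectation (\<lambda>w. (A i T w)\<^sup>2) \<le> K * real T"
proof -
  obtain u where u: "\<And>g. g \<subseteq> {..<P} \<Longrightarrow> u g = psi i g + (\<Sum>j<P. sel g j * u (flip g j))"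
    using psi_Poisson[OF assms] by blast
  define Ku where "Ku g = (\<Sum>j<P. sel g j * u (flip g j))" for g
  define U where "U = (\<Sum>g\<in>Pow {..<P}. \<bar>u g\<bar> + \<bar>Ku g\<bar>)"
  have U_ge: "\<bar>u g\<bar> + \<bar>Ku g\<bar> \<le> U" if "g \<subseteq> {..<P}" for g
    unfolding U_def using that by (intro member_le_sum) auto
  have U: "\<bar>u g\<bar> \<le> U" "\<bar>Ku g\<bar> \<le> U" if "g \<subseteq> {..<P}" for g
    using U_ge[OF that] by linarith+
  \<comment> \<open>Centred for every update probability: an update averages \<open>u\<close> over
    the flips, which gives \<open>Ku\<close>, and an iteration without update contributes
    zero.\<close>
  define d where "d t x y = (if snd y then u (fst y) - Ku (fst x) else 0)"
    for t :: nat and x y :: "nat set \<times> bool"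
  have d_Z: "d t (Z t w) (Z (Suc t) w) = (if Q (Suc t) w then u (G (Suc t) w) - Ku (G t w) else 0)" for t w
    by (simp add: d_def Z_def)
  have d_measurable: "(\<lambda>w. d t (Z t w) (Z (Suc t) w)) \<in> borel_measurable M" for t
    unfolding d_Z by measurable
  have d_bound: "\<bar>d t x y\<bar> \<le> 2 * U" if "x \<in> Pow {..<P} \<times> UNIV" "y \<in> Pow {..<P} \<times> UNIV" for t x y
    using U[of "fst x"] U[of "fst y"] that by (auto simp: d_def)
  have "(\<Sum>y\<in>Pow {..<P} \<times> UNIV. (\<lambda>(a, _) (b, q). vtrans (Suc t) a q b) x y * d t x y) = 0"
    if "x \<in> Pow {..<P} \<times> UNIV" for t x
  proof -
    have a: "fst x \<subseteq> {..<P}" using that by auto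
    have "(\<Sum>y\<in>Pow {..<P} \<times> UNIV. (\<lambda>(a, _) (b, q). vtrans (Suc t) a q b) x y * d t x y)
      = (\<Sum>(b, q)\<in>Pow {..<P} \<times> UNIV. vtrans (Suc t) (fst x) q b * (if q then u b - Ku (fst x) else 0))"
      by (intro sum.cong refl) (auto simp: d_def case_prod_beta)
    also have "\<dots> = (if Suc t = 1 then 1 else alpha) * (\<Sum>j<P. sel (fst x) j * (u (flip (fst x) j) - Ku (fst x)))"
      by (subst sum_vtrans[OF a]) simp
    also have "(\<Sum>j<P. sel (fst x) j * (u (flip (fst x) j) - Ku (fst x))) = 0"
      using sum_sel[OF a]
      by (simp add: right_diff_distrib sum_subtractf Ku_def sum_distrib_right[symmetric])
    finally show ?thesis by simp
  qed
  note moment = Z.martingale_second_moment[OF d_measurable d_bound this]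
  have "expectation (\<lambda>w. (A i T w)\<^sup>2) \<le> 16 * U\<^sup>2 * real T" for T
  proof (cases "T = 0")
    case False
    have "AE w in M. \<bar>A i T w - (\<Sum>t<T. d t (Z t w) (Z (Suc t) w))\<bar> \<le> 2 * U"
      using AE_run
    proof eventually_elim
      case (elim w)
      \<comment> \<open>A step with \<open>Q = 0\<close> does not move, so the corrector telescopes over all steps.\<close>
      have "(if Q (Suc t) w then psi i (G (Suc t) w) else 0) - d t (Z t w) (Z (Suc t) w)
          = Ku (G t w) - Ku (G (Suc t) w)" for t
        using elim u[of "G (Suc t) w"] by (auto simp: d_Z Ku_def)
      then have "A i T w - (\<Sum>t<T. d t (Z t w) (Z (Suc t) w)) = (\<Sum>t<T. Ku (G t w) - Ku (G (Suc t) w))"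
        by (simp add: A_def sum_subtractf[symmetric])
      also have "\<dots> = Ku (G 0 w) - Ku (G T w)"
        by (rule sum_lessThan_telescope')
      finally show ?case
        using U(2)[of "G 0 w"] U(2)[of "G T w"] elim by auto
    qed
    from second_moment_perturb[OF Z.martingale_square_integrable[OF d_measurable d_bound] this]
    have "expectation (\<lambda>w. (A i T w)\<^sup>2) \<le> 2 * ((2 * U)\<^sup>2 * real T) + 2 * (2 * U)\<^sup>2"
      using moment[of T] by simp
    \<comment> \<open>For \<open>T \<ge> 1\<close> the constant \<open>8 * U\<^sup>2\<close> left by
      the telescoping is absorbed into the linear term.\<close>
    also have "\<dots> \<le> 16 * U\<^sup>2 * real T"
      using False mult_left_mono[of 1 "real T" "8 * U\<^sup>2"] by (simp add: power_mult_distrib mult.commute)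
    finally show ?thesis .
  qed (simp add: A_def)
  then show ?thesis by (rule that)
qed

lemma N_second_moment: "expectation (\<lambda>w. (N T w - alpha * real T)\<^sup>2) \<le> 4 * real T"
proof (cases "T = 0")
  case False
  \<comment> \<open>The forced update at iteration \<open>1\<close> is not centred around
    \<open>alpha\<close>; its increment is set to zero, at a cost of
    \<open>1 - alpha\<close>.\<close>
  define d where "d t x y = (if t = 0 then 0 else (if snd y then 1 else 0) - alpha)"
    for t :: nat and x y :: "nat set \<times> bool"
  have d_Z: "d t (Z t w) (Z (Suc t) w) = (if t = 0 then 0 else (if Q (Suc t) w then 1 else 0) - alpha)" for t w
    by (simp add: d_def Z_def)
  have d_measurable: "(\<lambda>w. d t (Z t w) (Z (Suc t) w)) \<in> borel_measurable M" for t
    unfolding d_Z by measurable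
  have d_bound: "\<bar>d t x y\<bar> \<le> 1" for t x y
    using alpha_bounds by (auto simp: d_def)
  have "(\<Sum>y\<in>Pow {..<P} \<times> UNIV. (\<lambda>(a, _) (b, q). vtrans (Suc t) a q b) x y * d t x y) = 0"
    if "x \<in> Pow {..<P} \<times> UNIV" for t x
  proof (cases "t = 0")
    case False
    have a: "fst x \<subseteq> {..<P}" using that by auto
    have "(\<Sum>y\<in>Pow {..<P} \<times> UNIV. (\<lambda>(a, _) (b, q). vtrans (Suc t) a q b) x y * d t x y)
      = (\<Sum>(b, q)\<in>Pow {..<P} \<times> UNIV. vtrans (Suc t) (fst x) q b * ((if q then 1 else 0) - alpha))"
      using False by (intro sum.cong refl) (auto simp: d_def case_prod_beta)
    also have "\<dots> = alpha * (\<Sum>j<P. sel (fst x) j * (1 - alpha)) - (1 - alpha) * alpha"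
      using False by (subst sum_vtrans[OF a]) simp
    also have "\<dots> = 0"
      using sum_sel[OF a] by (simp add: sum_distrib_right[symmetric])
    finally show ?thesis .
  qed (simp add: d_def)
  note moment = Z.martingale_second_moment[OF d_measurable d_bound this]
  have "AE w in M. \<bar>(N T w - alpha * real T) - (\<Sum>t<T. d t (Z t w) (Z (Suc t) w))\<bar> \<le> 1"
    using AE_run
  proof eventually_elim
    case (elim w)
    have "(N T w - alpha * real T) - (\<Sum>t<T. d t (Z t w) (Z (Suc t) w))
        = (\<Sum>t<T. (if Q (Suc t) w then 1 else 0) - alpha - d t (Z t w) (Z (Suc t) w))"
      by (simp add: N_def sum_subtractf mult.commute)
    also have "\<dots> = (\<Sum>t<T. if t = 0 then 1 - alpha else 0)"
      using elim by (intro sum.cong refl) (auto simp: d_Z)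
    also have "\<dots> = 1 - alpha"
      using False by simp
    finally show ?case using alpha_bounds by simp
  qed
  from second_moment_perturb[OF Z.martingale_square_integrable[OF d_measurable d_bound] this]
  have "expectation (\<lambda>w. (N T w - alpha * real T)\<^sup>2) \<le> 2 * (1\<^sup>2 * real T) + 2 * 1\<^sup>2"
    using moment[of T] by simp
  also have "\<dots> \<le> 4 * real T" using False by simp
  finally show ?thesis .
qed (simp add: N_def)

section \<open>Almost sure limits of the averages\<close>

lemma AE_A_average:
  assumes "i < P"
  shows "AE w in M. (\<lambda>T. A i T w / real T) \<longlonglongrightarrow> 0"
proof -
  obtain K where K: "\<And>T. expectation (\<lambda>w. (A i T w)\<^sup>2) \<le> K * real T"
    using A_second_moment[OF assms] by blast
  obtain C where C: "\<And>g. g \<subseteq> {..<P} \<Longrightarrow> \<bar>psi i g\<bar> \<le> C"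
    using psi_bound by blast
  have C0: "0 \<le> C" using C[of "{}"] by simp
  show ?thesis
    unfolding A_def
  proof (rule AE_average_tendsto_0)
    show "AE w in M. \<forall>t. \<bar>if Q (Suc t) w then psi i (G (Suc t) w) else 0\<bar> \<le> C"
      using AE_run by eventually_elim (auto intro: C C0)
  qed (use K in \<open>auto simp: A_def\<close>)
qed

lemma AE_N_average: "AE w in M. (\<lambda>T. N T w / real T) \<longlonglongrightarrow> alpha"
proof -
  have eq: "(\<Sum>t<T. (if Q (Suc t) w then 1 else 0) - alpha) = N T w - alpha * real T" for T w
    by (simp add: N_def sum_subtractf mult.commute)
  have "AE w in M. (\<lambda>T. (\<Sum>t<T. (if Q (Suc t) w then 1 else 0) - alpha) / real T) \<longlonglongrightarrow> 0"
  proof (rule AE_average_tendsto_0)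
    show "AE w in M. \<forall>t. \<bar>(if Q (Suc t) w then 1 else 0) - alpha\<bar> \<le> 1"
      using alpha_bounds by (auto intro!: AE_I2)
  qed (use N_second_moment in \<open>auto simp: eq\<close>)
  then show ?thesis
  proof eventually_elim
    case (elim w)
    have "(\<lambda>T. (N T w - alpha * real T) / real T + alpha) \<longlonglongrightarrow> 0 + alpha"
      using elim unfolding eq by (intro tendsto_add tendsto_const)
    moreover have "\<forall>\<^sub>F T in sequentially. (N T w - alpha * real T) / real T + alpha = N T w / real T"
      using eventually_gt_at_top[of 0] by eventually_elim (simp add: field_simps)
    ultimately show ?case by (simp add: tendsto_cong)
  qed
qed

section \<open>Error bounds for the estimator\<close>

lemma N_le_W:
  assumes "\<And>t. G t w \<subseteq> {..<P}" and "\<And>g. g \<subseteq> {..<P} \<Longrightarrow> phi g \<le> Phi"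
  shows "N T w \<le> Phi * W T w"
  unfolding N_def W_def sum_distrib_left
  using assms phi_pos by (intro sum_mono) (simp add: le_divide_eq)

text \<open>Iterations without update carry weight zero, so the value \<open>1\<close> of
  \<open>rho_tilde\<close> there never enters, and the common denominator is
  \<open>W\<close>.\<close>

lemma est_E_eq:
  "est_E P pst eta G Q i T w
    = (\<Sum>t<T. if Q (Suc t) w then eta (G (Suc t) w - {i}) i / phi (G (Suc t) w) else 0) / W T w"
proof -
  have W: "(\<Sum>s\<in>{1..T}. rho_tilde P pst eta G Q s w * (if Q s w then 1 else 0)) = W T w"
    by (auto simp: W_def rho_tilde_def sum.atLeast1_atMost_eq intro!: sum.cong)
  have "est_E P pst eta G Q i T w = (\<Sum>t\<in>{1..T}.
      (if Q t w then eta (G t w - {i}) i / phi (G t w) else 0) / W T w)"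
    unfolding est_E_def rho_def W by (intro sum.cong refl) (auto simp: rho_tilde_def)
  then show ?thesis
    by (simp add: sum_divide_distrib[symmetric] sum.atLeast1_atMost_eq)
qed

lemma est_E_error:
  assumes "W T w \<noteq> 0"
  shows "est_E P pst eta G Q i T w - PIP P pst i = A i T w / W T w"
proof -
  have "A i T w = (\<Sum>t<T. if Q (Suc t) w then eta (G (Suc t) w - {i}) i / phi (G (Suc t) w) else 0)
      - PIP P pst i * W T w"
    unfolding A_def W_def sum_distrib_left sum_subtractf[symmetric]
    by (intro sum.cong refl) (simp add: psi_def diff_divide_distrib)
  then show ?thesis using assms by (simp add: est_E_eq diff_divide_distrib)
qed

text \<open>The estimate is a weighted mean of numbers in \<open>[0, 1]\<close>, or \<open>0\<close>
  by division by zero when no update has occurred; \<open>PIP\<close> lies in \<open>[0, 1]\<close>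
  as well.\<close>

lemma est_E_error_le_1:
  assumes G: "\<And>t. G t w \<subseteq> {..<P}" and "i < P"
  shows "\<bar>est_E P pst eta G Q i T w - PIP P pst i\<bar> \<le> 1"
proof -
  have "0 \<le> est_E P pst eta G Q i T w"
    unfolding est_E_eq W_def using G assms(2) phi_pos cond_one_bounds(1)
    by (intro divide_nonneg_nonneg sum_nonneg) (auto simp: less_imp_le)
  moreover have "est_E P pst eta G Q i T w \<le> 1"
    unfolding est_E_eq
  proof (rule divide_le_eq_1[THEN iffD2])
    have "(\<Sum>t<T. if Q (Suc t) w then eta (G (Suc t) w - {i}) i / phi (G (Suc t) w) else 0) \<le> W T w"
      unfolding W_def using G assms(2) phi_pos cond_one_bounds(2)
      by (intro sum_mono) (auto simp: divide_right_mono less_imp_le)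
    moreover have "0 \<le> W T w"
      unfolding W_def using G phi_pos by (intro sum_nonneg) (auto simp: less_imp_le)
    ultimately show "0 < W T w \<and> (\<Sum>t<T. if Q (Suc t) w then eta (G (Suc t) w - {i}) i / phi (G (Suc t) w) else 0) \<le> W T w \<or>
      W T w < 0 \<and> W T w \<le> (\<Sum>t<T. if Q (Suc t) w then eta (G (Suc t) w - {i}) i / phi (G (Suc t) w) else 0) \<or> W T w = 0"
      by linarith
  qed
  ultimately show ?thesis using PIP_bounds[of i] by linarith
qed

text \<open>Each update adds at least \<open>1 / Phi\<close> to \<open>W\<close>, so the random
  denominator can be replaced by the update count.\<close>

lemma est_E_error_le:
  assumes G: "\<And>t. G t w \<subseteq> {..<P}" and Phi: "\<And>g. g \<subseteq> {..<P} \<Longrightarrow> phi g \<le> Phi"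
    and N: "0 < N T w"
  shows "\<bar>est_E P pst eta G Q i T w - PIP P pst i\<bar> \<le> Phi * \<bar>A i T w\<bar> / N T w"
proof -
  have Phi_pos: "0 < Phi" using Phi[of "{}"] phi_pos[of "{}"] by simp
  have NW: "N T w \<le> Phi * W T w" by (rule N_le_W[OF G Phi])
  then have W: "0 < W T w" using N Phi_pos by (metis less_le_trans zero_less_mult_pos)
  have "\<bar>est_E P pst eta G Q i T w - PIP P pst i\<bar> = Phi * \<bar>A i T w\<bar> / (Phi * W T w)"
    using W Phi_pos by (simp add: est_E_error)
  also have "\<dots> \<le> Phi * \<bar>A i T w\<bar> / N T w"
    using NW N W Phi_pos by (intro divide_left_mono) auto
  finally show ?thesis .
qed

lemma AE_est_E_tendsto:
  assumes "i < P"
  shows "AE w in M. (\<lambda>T. est_E P pst eta G Q i T w) \<longlonglongrightarrow> PIP P pst i"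
  using AE_run AE_A_average[OF assms] AE_N_average
proof eventually_elim
  case (elim w)
  define Phi where "Phi = Max (phi ` Pow {..<P})"
  have Phi: "phi g \<le> Phi" if "g \<subseteq> {..<P}" for g
    unfolding Phi_def using that by (intro Max_ge) auto
  \<comment> \<open>Numerator and denominator of the error bound are both divided by
    \<open>T\<close>, so that each has a limit.\<close>
  have "(\<lambda>T. Phi * \<bar>A i T w / real T\<bar> / (N T w / real T)) \<longlonglongrightarrow> Phi * \<bar>0\<bar> / alpha"
    using elim alpha_bounds by (intro tendsto_intros) auto
  then have lim: "(\<lambda>T. Phi * \<bar>A i T w / real T\<bar> / (N T w / real T)) \<longlonglongrightarrow> 0" by simp
  have "\<forall>\<^sub>F T in sequentially. 0 < N T w / real T"
    using elim(3) alpha_bounds(1) by (rule order_tendstoD)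
  then have "\<forall>\<^sub>F T in sequentially. norm (est_E P pst eta G Q i T w - PIP P pst i)
      \<le> Phi * \<bar>A i T w / real T\<bar> / (N T w / real T)"
    using eventually_gt_at_top[of 0]
  proof eventually_elim
    case T: (elim T)
    then have "0 < N T w" by (simp add: zero_less_divide_iff)
    with est_E_error_le[of w Phi T i] elim(1) Phi T show ?case by simp
  qed
  from Lim_null_comparison[OF this lim] show ?case by (rule LIM_zero_cancel)
qed

text \<open>The cases are whether \<open>N\<close> reaches half of \<open>alpha * real T\<close>. If
  so, the error is controlled by \<open>A\<close>; otherwise it is at most \<open>1\<close> and the
  deviation of \<open>N\<close> pays for it. Both second moments are linear in \<open>T\<close> and
  get divided by the square of \<open>T\<close>.\<close>

lemma est_E_mean_square:
  assumes "i < P"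
  obtains K where "\<And>T. 1 \<le> T \<Longrightarrow>
    expectation (\<lambda>w. \<bar>est_E P pst eta G Q i T w - PIP P pst i\<bar>\<^sup>2) \<le> K / real T"
proof -
  obtain K where K: "\<And>T. expectation (\<lambda>w. (A i T w)\<^sup>2) \<le> K * real T"
    using A_second_moment[OF assms] by blast
  obtain C where C: "\<And>g. g \<subseteq> {..<P} \<Longrightarrow> \<bar>psi i g\<bar> \<le> C"
    using psi_bound by blast
  have C0: "0 \<le> C" using C[of "{}"] by simp
  define Phi where "Phi = Max (phi ` Pow {..<P})"
  have Phi: "phi g \<le> Phi" if "g \<subseteq> {..<P}" for g
    unfolding Phi_def using that by (intro Max_ge) auto
  have bound: "expectation (\<lambda>w. \<bar>est_E P pst eta G Q i T w - PIP P pst i\<bar>\<^sup>2)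
      \<le> (4 * Phi\<^sup>2 * K + 16) / alpha\<^sup>2 / real T" if T: "1 \<le> T" for T
  proof -
    \<comment> \<open>Dominates the squared error in both cases; each \<open>4\<close> is the square
      of the \<open>2\<close> in \<open>alpha * real T / 2\<close>.\<close>
    define R where "R w = 4 * Phi\<^sup>2 / (alpha * real T)\<^sup>2 * (A i T w)\<^sup>2
        + 4 / (alpha * real T)\<^sup>2 * (N T w - alpha * real T)\<^sup>2" for w
    have aT: "0 < alpha * real T" using alpha_bounds T by simp
    have [measurable]: "A i T \<in> borel_measurable M" "N T \<in> borel_measurable M"
      unfolding A_def[abs_def] N_def[abs_def] by measurable
    have "AE w in M. \<bar>A i T w\<bar> \<le> real T * C"
      using AE_run
    proof eventually_elim
      case (elim w)
      have "\<bar>A i T w\<bar> \<le> (\<Sum>t<T. \<bar>if Q (Suc t) w then psi i (G (Suc t) w) else 0\<bar>)"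
        unfolding A_def by (rule sum_abs)
      also have "\<dots> \<le> (\<Sum>t<T. C)" using elim C C0 by (intro sum_mono) auto
      finally show ?case by simp
    qed
    then have "AE w in M. norm ((A i T w)\<^sup>2) \<le> (real T * C)\<^sup>2"
      by eventually_elim (simp add: abs_le_square_iff[symmetric])
    then have int_A: "integrable M (\<lambda>w. (A i T w)\<^sup>2)"
      by (rule integrable_const_bound) measurable
    have N_bounds: "0 \<le> N T w" "N T w \<le> real T" for w
      using sum_mono[of "{..<T}" "\<lambda>t. if Q (Suc t) w then 1 else 0 :: real" "\<lambda>_. 1"]
      by (auto simp: N_def intro!: sum_nonneg)
    have "\<bar>N T w - alpha * real T\<bar> \<le> real T" for w
      using N_bounds[of w] alpha_bounds mult_right_mono[of alpha 1 "real T"] aT by (auto simp: abs_le_iff)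
    then have "AE w in M. norm ((N T w - alpha * real T)\<^sup>2) \<le> (real T)\<^sup>2"
      by (simp add: abs_le_square_iff[symmetric])
    then have int_N: "integrable M (\<lambda>w. (N T w - alpha * real T)\<^sup>2)"
      by (rule integrable_const_bound) measurable
    have int_R: "integrable M R"
      unfolding R_def[abs_def] using int_A int_N by simp
    \<comment> \<open>Where \<open>N T\<close> falls below half its mean, the second term of \<open>R\<close> is at least \<open>1\<close>.\<close>
    have "AE w in M. \<bar>est_E P pst eta G Q i T w - PIP P pst i\<bar>\<^sup>2 \<le> R w"
      using AE_run
    proof eventually_elim
      case (elim w)
      let ?e = "\<bar>est_E P pst eta G Q i T w - PIP P pst i\<bar>"
      show ?case
      proof (cases "alpha * real T / 2 \<le> N T w")
        case True
        then have "?e \<le> Phi * \<bar>A i T w\<bar> / N T w"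
          using elim Phi aT by (intro est_E_error_le) auto
        also have "\<dots> \<le> Phi * \<bar>A i T w\<bar> / (alpha * real T / 2)"
          using True aT Phi[of "{}"] phi_pos[of "{}"] by (intro divide_left_mono) auto
        finally have "?e\<^sup>2 \<le> (Phi * \<bar>A i T w\<bar> / (alpha * real T / 2))\<^sup>2"
          by (intro power_mono) auto
        also have "\<dots> = 4 * Phi\<^sup>2 / (alpha * real T)\<^sup>2 * (A i T w)\<^sup>2"
          by (simp add: power_mult_distrib power_divide)
        also have "\<dots> \<le> R w" by (simp add: R_def)
        finally show ?thesis .
      next
        case False
        have "?e\<^sup>2 \<le> 1"
          using est_E_error_le_1[of w i T] elim assms by (intro power_le_one) auto
        also have "1 = 4 / (alpha * real T)\<^sup>2 * (alpha * real T / 2)\<^sup>2"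
          using alpha_bounds T by (simp add: power_divide)
        also have "\<dots> \<le> 4 / (alpha * real T)\<^sup>2 * (N T w - alpha * real T)\<^sup>2"
          using False aT
          by (intro mult_left_mono) (auto simp: abs_le_square_iff[symmetric] mult.commute)
        also have "\<dots> \<le> R w" by (simp add: R_def)
        finally show ?thesis .
      qed
    qed
    then have "expectation (\<lambda>w. \<bar>est_E P pst eta G Q i T w - PIP P pst i\<bar>\<^sup>2) \<le> expectation R"
      by (rule integral_mono_AE'[OF int_R]) (simp add: R_def)
    also have "expectation R = 4 * Phi\<^sup>2 / (alpha * real T)\<^sup>2 * expectation (\<lambda>w. (A i T w)\<^sup>2)
        + 4 / (alpha * real T)\<^sup>2 * expectation (\<lambda>w. (N T w - alpha * real T)\<^sup>2)"
      unfolding R_def[abs_def] using int_A int_N by simp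
    also have "\<dots> \<le> 4 * Phi\<^sup>2 / (alpha * real T)\<^sup>2 * (K * real T) + 4 / (alpha * real T)\<^sup>2 * (4 * real T)"
      by (intro add_mono mult_left_mono K N_second_moment) auto
    also have "\<dots> = (4 * Phi\<^sup>2 * K + 16) / alpha\<^sup>2 / real T"
      using alpha_bounds T by (simp add: power2_eq_square field_simps)
    finally show ?thesis .
  qed
  then show ?thesis by (rule that)
qed

end

section \<open>From the \<open>1 / T\<close> bound to the stated rate\<close>

theorem theorem1:
  fixes N P S :: nat and X :: "nat \<Rightarrow> nat \<Rightarrow> real" and Y :: "nat \<Rightarrow> real"
    and h tau nu0 lambda0 :: real and i :: nat
    and M :: "'w measure" and G :: "nat \<Rightarrow> 'w \<Rightarrow> nat set" and Q :: "nat \<Rightarrow> 'w \<Rightarrow> bool"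
  defines "pst \<equiv> post N P X Y h tau nu0 lambda0"
  defines "eta \<equiv> cond_one pst"
  assumes "0 < h" "h < 1" "0 < tau" "0 < nu0" "0 < lambda0"
    and "1 \<le> S" "S \<le> P" and "i < P"
    and run: "is_vc_wtgs_run M P S h pst eta G Q"
  shows "(AE w in M. (\<lambda>T. est_E P pst eta G Q i T w) \<longlonglongrightarrow> PIP P pst i) \<and>
         (\<lambda>T. integral\<^sup>L M (\<lambda>w. \<bar>est_E P pst eta G Q i T w - PIP P pst i\<bar> ^ 2))
           \<in> O(\<lambda>T. ln (real T) / real T * (real P / real S) ^ 2 *
                 ((MAX g\<in>Pow {..<P}. wphi P pst eta g) / (MIN g\<in>Pow {..<P}. wphi P pst eta g)) ^ 2)"
proof -
  have P: "0 < P" using \<open>i < P\<close> by simp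
  interpret vc_wtgs_run P pst M S h G Q
  proof (intro vc_wtgs_run.intro vc_wtgs_run_axioms.intro)
    show "wtgs_target P pst"
      using P post_pos[OF assms(3-7)] sum_post[OF assms(3-7)]
      by unfold_locales (auto simp: pst_def)
    show "prob_space M" using run by (simp add: is_vc_wtgs_run_def)
    show "1 \<le> S" "S \<le> P" "is_vc_wtgs_run M P S h pst (cond_one pst) G Q"
      using assms(8,9) run by (simp_all add: eta_def)
  qed
  \<comment> \<open>The factor of the rate that is free of \<open>T\<close>; being positive, it can
    be divided out into the implied constant.\<close>
  define c where "c = (real P / real S) ^ 2 *
    ((MAX g\<in>Pow {..<P}. wphi P pst eta g) / (MIN g\<in>Pow {..<P}. wphi P pst eta g)) ^ 2"
  have "(MAX g\<in>Pow {..<P}. wphi P pst eta g) \<in> wphi P pst eta ` Pow {..<P}"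
    "(MIN g\<in>Pow {..<P}. wphi P pst eta g) \<in> wphi P pst eta ` Pow {..<P}"
    by (intro Max_in Min_in; auto)+
  then have "0 < (MAX g\<in>Pow {..<P}. wphi P pst eta g)" "0 < (MIN g\<in>Pow {..<P}. wphi P pst eta g)"
    using phi_pos unfolding eta_def by (metis PowD imageE)+
  then have c: "0 < c"
    unfolding c_def using P S by (intro mult_pos_pos zero_less_power divide_pos_pos) auto
  obtain K where K: "\<And>T. 1 \<le> T \<Longrightarrow>
      expectation (\<lambda>w. \<bar>est_E P pst eta G Q i T w - PIP P pst i\<bar> ^ 2) \<le> K / real T"
    using est_E_mean_square[OF \<open>i < P\<close>] unfolding eta_def by blast
  have "(\<lambda>T. expectation (\<lambda>w. \<bar>est_E P pst eta G Q i T w - PIP P pst i\<bar> ^ 2))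
      \<in> O(\<lambda>T. ln (real T) / real T * c)"
  proof (rule bigoI[where c = "\<bar>K\<bar> / c"])
    show "\<forall>\<^sub>F T in sequentially.
        norm (expectation (\<lambda>w. \<bar>est_E P pst eta G Q i T w - PIP P pst i\<bar> ^ 2))
        \<le> \<bar>K\<bar> / c * norm (ln (real T) / real T * c)"
      \<comment> \<open>From \<open>T = 3\<close> on, \<open>ln (real T)\<close> is at least
        \<open>1\<close>, so the bound \<open>K / real T\<close> implies the weaker rate.\<close>
      using eventually_ge_at_top[of 3]
    proof eventually_elim
      case (elim T)
      have "exp 1 \<le> real T" using exp_le elim by linarith
      then have ln: "1 \<le> ln (real T)" using elim by (simp add: ln_ge_iff)
      have "norm (expectation (\<lambda>w. \<bar>est_E P pst eta G Q i T w - PIP P pst i\<bar> ^ 2)) \<le> K / real T"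
        using K[of T] elim by (simp add: Bochner_Integration.integral_nonneg)
      also have "\<dots> \<le> \<bar>K\<bar> * ln (real T) / real T"
        using mult_left_mono[OF ln, of "\<bar>K\<bar>"] elim by (intro divide_right_mono) auto
      also have "\<dots> = \<bar>K\<bar> / c * norm (ln (real T) / real T * c)"
        using ln c by (simp add: abs_mult)
      finally show ?case .
    qed
  qed
  then show ?thesis
    using AE_est_E_tendsto[OF \<open>i < P\<close>] by (simp add: c_def eta_def mult.assoc)
qed

end
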